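(* Let $X_1,\dots,X_n$ be independent zero-mean (integrable) real random variables, and let $U_1,\dots,U_n$ be independent random variables uniformly distributed on $[0,1]$ which are also independent of $X_1,\dots,X_n$. For each $j$ let $\mathsf r_j:=\mathsf r_{X_j}$ be the reciprocating function of $X_j$ and $R_j:=\mathsf r_j(X_j,U_j)$. Let $g\colon\mathbb R^{2n}\to\mathbb R$ be any Borel function bounded from below (or from above). Then $$\mathsf E\, g(X_1,R_1,\dots,X_n,R_n)=\int_{(\mathbb R\times[0,1])^n}\mathsf E\, g\big(X_{1;p_1},R_{1;p_1},\dots,X_{n;p_n},R_{n;p_n}\big)\,\prod_{j=1}^n\mathsf P(X_j\in dx_j)\,du_j,$$ where, for each $j$, $p_j$ stands for the pair $x_j,\mathsf r_j(x_j,u_j)$. Instead of the condition that $g$ be bounded from below or above, it is enough to require only that, for some real constants $c_1,\dots,c_n$, the function $g(x_1,r_1,\dots,x_n,r_n)-c_1x_1-\dots-c_nx_n$ be bounded from below (or from above) over all real $x_1,r_1,\dots,x_n,r_n$.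
   Context: Reciprocating function. For a finite nonnegative Borel measure $\nu$ on $\mathbb R$ (extended to $[-\infty,\infty]$ by $\nu(\{\pm\infty\})=0$) define $G=G_\nu\colon[-\infty,\infty]\to[0,\infty]$ by $G(x)=\int_{(0,x]}z\,\nu(dz)$ for $x\in[0,\infty]$ and $G(x)=\int_{[x,0)}(-z)\,\nu(dz)$ for $x\in[-\infty,0]$. For $h\in[-\infty,\infty]$ let $x_+(h)=\inf\{x\in[0,\infty]\colon G(x)\ge h\}$ and $x_-(h)=\sup\{x\in[-\infty,0]\colon G(x)\ge h\}$ (with $\inf\emptyset=\infty$, $\sup\emptyset=-\infty$). For $u\in[0,1]$ let $\tilde G(x,u)=G(x-)+(G(x)-G(x-))u$ if $x\in[0,\infty]$ and $\tilde G(x,u)=G(x+)+(G(x)-G(x+))u$ if $x\in[-\infty,0]$ (one-sided limits; note $G$ is continuous at $0$, $G(0)=0$). The reciprocating function of $\nu$ is $\mathsf r_\nu(x,u)=x_-(\tilde G(x,u))$ if $x\in[0,\infty]$ and $\mathsf r_\nu(x,u)=x_+(\tilde G(x,u))$ if $x\in[-\infty,0]$, $u\in[0,1]$. For a random variable $X$, $\mathsf r_X:=\mathsf r_\nu$ with $\nu$ the distribution of $X$. Two-point variables. For any real $a_1,b_1,\dots,a_n,b_n$ with $a_jb_j\le0$ for all $j$, $X_{1;a_1,b_1},\dots,X_{n;a_n,b_n}$ denote independent random variables such that $X_{j;a_j,b_j}$ is zero-mean and takes values in $\{a_j,b_j\}$ (its distribution is then uniquely determined; it is $0$ a.s. if $a_jb_j=0$).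 Further, $R_{j;a_j,b_j}:=a_jb_j/X_{j;a_j,b_j}$ if $a_jb_j<0$ and $R_{j;a_j,b_j}:=0$ if $a_jb_j=0$. The values $\mathsf r_j(x,u)$ are finite for almost all $(x,u)$ with respect to $\mathsf P(X_j\in dx)\,du$; on the exceptional null set the integrand (and the function $g$) may be given arbitrary values. *)

theory Defs
  imports "HOL-Probability.Probability"
begin

definition recip_G :: "real measure \<Rightarrow> ereal \<Rightarrow> ereal" where
  "recip_G \<nu> x =
    (if 0 \<le> x
     then enn2ereal (\<integral>\<^sup>+z\<in>{z. 0 < z \<and> ereal z \<le> x}. ennreal z \<partial>\<nu>)
     else enn2ereal (\<integral>\<^sup>+z\<in>{z. x \<le> ereal z \<and> z < 0}. ennreal (- z) \<partial>\<nu>))"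

definition recip_x_plus :: "real measure \<Rightarrow> ereal \<Rightarrow> ereal" where
  "recip_x_plus \<nu> h = Inf {x. 0 \<le> x \<and> h \<le> recip_G \<nu> x}"

definition recip_x_minus :: "real measure \<Rightarrow> ereal \<Rightarrow> ereal" where
  "recip_x_minus \<nu> h = Sup {x. x \<le> 0 \<and> h \<le> recip_G \<nu> x}"

text \<open>
  The two branches of the next two definitions agree at \<open>x = 0\<close> (for finite \<open>\<nu>\<close>), where the
  resulting value of \<open>reciprocating\<close> is 0.  The parameter \<open>u\<close> is meant to range over \<open>[0, 1]\<close>.
\<close>

definition recip_G_tilde :: "real measure \<Rightarrow> ereal \<Rightarrow> real \<Rightarrow> ereal" where
  "recip_G_tilde \<nu> x u =
    (let l = (if 0 \<le> x then Lim (at_left x) (recip_G \<nu>) else Lim (at_right x) (recip_G \<nu>))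
     in l + (recip_G \<nu> x - l) * ereal u)"

definition reciprocating :: "real measure \<Rightarrow> ereal \<Rightarrow> real \<Rightarrow> ereal" where
  "reciprocating \<nu> x u =
    (if 0 \<le> x then recip_x_minus \<nu> (recip_G_tilde \<nu> x u)
     else recip_x_plus \<nu> (recip_G_tilde \<nu> x u))"

definition recip_rv :: "'a measure \<Rightarrow> ('a \<Rightarrow> real) \<Rightarrow> real \<Rightarrow> real \<Rightarrow> ereal" where
  "recip_rv M X x u = reciprocating (distr M borel X) (ereal x) u"

text \<open>
  \<open>Y j\<close>, for \<open>j \<in> {1..n}\<close>, are independent zero-mean random variables on the probability space
  \<open>N\<close>, with \<open>Y j\<close> taking values in \<open>{a j, b j}\<close> almost surely.
\<close>

definition two_point_vars ::
    "nat \<Rightarrow> 'b measure \<Rightarrow> (nat \<Rightarrow> real) \<Rightarrow> (nat \<Rightarrow> real) \<Rightarrow> (nat \<Rightarrow> 'b \<Rightarrow> real) \<Rightarrow> bool" where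
  "two_point_vars n N a b Y \<longleftrightarrow>
     prob_space N \<and>
     prob_space.indep_vars N (\<lambda>_. borel) Y {1..n} \<and>
     (\<forall>j\<in>{1..n}. (AE \<omega> in N. Y j \<omega> \<in> {a j, b j}) \<and>
                 integrable N (Y j) \<and> (\<integral>\<omega>. Y j \<omega> \<partial>N) = 0)"

text \<open>With \<open>y\<close> the value of the two-point variable for \<open>a\<close>, \<open>b\<close>, the value of its reciprocal
  partner \<open>R\<close>.\<close>

definition two_point_R :: "real \<Rightarrow> real \<Rightarrow> real \<Rightarrow> real" where
  "two_point_R a b y = (if a * b < 0 then a * b / y else 0)"

text \<open>
  Extended-valued integral of a real function, as the difference of the integrals of its positive
  and negative parts (note that \<open>ennreal\<close> maps negative reals to 0).  It is meaningful for
  quasi-integrable functions, i.e. when at most one of the two is infinite.  Measurability is up to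
  null sets, so that changing a function arbitrarily on a null set affects neither notion.
\<close>

definition quasi_integrable :: "'a measure \<Rightarrow> ('a \<Rightarrow> real) \<Rightarrow> bool" where
  "quasi_integrable M f \<longleftrightarrow>
     f \<in> borel_measurable (completion M) \<and>
     ((\<integral>\<^sup>+x. ennreal (f x) \<partial>M) < \<infinity> \<or> (\<integral>\<^sup>+x. ennreal (- f x) \<partial>M) < \<infinity>)"

definition ext_integral :: "'a measure \<Rightarrow> ('a \<Rightarrow> real) \<Rightarrow> ereal" where
  "ext_integral M f =
     enn2ereal (\<integral>\<^sup>+x. ennreal (f x) \<partial>M) - enn2ereal (\<integral>\<^sup>+x. ennreal (- f x) \<partial>M)"

text \<open>
  \<open>g\<close>, a function of \<open>n\<close> pairs \<open>(x\<^sub>j, r\<^sub>j)\<close> of reals, is bounded from below or from above on its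
  whole domain.
\<close>

definition bdd_below_or_above :: "nat \<Rightarrow> ((nat \<Rightarrow> real \<times> real) \<Rightarrow> real) \<Rightarrow> bool" where
  "bdd_below_or_above n g \<longleftrightarrow>
     bdd_below (g ` ({1..n} \<rightarrow>\<^sub>E UNIV)) \<or> bdd_above (g ` ({1..n} \<rightarrow>\<^sub>E UNIV))"

end

(*
  Fix one variable with law \<mu> and put G(x) = \<integral>_(0,x] z \<mu>(dz). Weighting \<mu> by |x| on either half-line
  gives two measures with the same mass m, because the mean is zero. Under these weighted measures,
  times the uniform law of u, the level G~(x, u) is uniform on (0, m), and the point with level h is
  the quantile x_+(h) or x_-(h), respectively. Hence exchanging x and r(x, u) carries x^+ \<mu>(dx) du to
  x^- \<mu>(dx) du. Splitting 1 = |r| / (|x| + |r|) + |x| / (|x| + |r|) and exchanging in the second part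
  shows that the law of (X, R) is invariant under the kernel sending (x, r) to the law of the
  two-point pair with values x, r. The invariance passes to products of independent pairs. Finally
  g is a linear form in the x_j plus a nonnegative function, and the linear form has the same
  integral on both sides because all variables are centred.
*)
theory Submission
  imports Defs
begin

text \<open>Without u all the mass of an atom of \<mu> would sit at one level; u spreads it
  uniformly over the jump of G, and only this makes the level uniform. The weights |r| / (|x| + |r|)
  and |x| / (|x| + |r|) are the probabilities with which a centred variable takes the values x and
  r. Their denominator is symmetric, so it survives the exchange of x and r, and only |x| = x^+ +
  x^- has to be exchanged. Invariance of the law of (X, R) under the kernel is already the claim:
  integrating against this law is the same as integrating first against the kernel at a pair p and
  then over p.

  Two obstacles shape the proof. The reciprocal is an extended real, finite only almost everywhere,
  and the integrands are prescribed only off a null set; hence a real Borel version and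
  measurability for the completion. Moreover g may have an infinite integral. Invariance is
  therefore used for nonnegative functions, where no difference of infinities arises, and the
  centred linear form is carried along as an integrable summand. A function bounded from above is
  treated through its negative.\<close>

section \<open>Quantiles and the smoothed distribution function\<close>

text \<open>Outside \<open>(0, M(UNIV))\<close> the infimum may be taken over an empty or unbounded set, hence the guard.\<close>

definition quantile :: "real measure \<Rightarrow> real \<Rightarrow> real" where
  "quantile M h = (if 0 < h \<and> h < measure M UNIV then Inf {x. h \<le> cdf M x} else 0)"

text \<open>
  At an atom, the second coordinate interpolates linearly across the jump of the distribution
  function; for the measure \<open>x \<nu>(dx)\<close> on the positive half-line this is the paper's \<open>G~(x, u)\<close>.
\<close>

definition smooth_cdf :: "real measure \<Rightarrow> real \<times> real \<Rightarrow> real" where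
  "smooth_cdf M z = measure M {..<fst z} + measure M {fst z} * snd z"

abbreviation (input) unif :: "real measure" where
  "unif \<equiv> uniform_measure lborel {0..1}"

lemma prob_space_unif: "prob_space unif"
  by (rule prob_space_uniform_measure) auto

lemma sigma_finite_unif: "sigma_finite_measure unif"
  by (rule prob_space_imp_sigma_finite[OF prob_space_unif])

lemma AE_unif: "AE u in unif. 0 \<le> u \<and> u \<le> 1"
  by (rule AE_uniform_measureI) auto

lemma emeasure_unif_lessThan:
  assumes "0 \<le> c" "c \<le> 1"
  shows "emeasure unif {..<c} = ennreal c"
proof -
  have "{0..1} \<inter> {..<c} = {0..<c}" using assms by auto
  then show ?thesis using assms by (simp add: divide_ennreal_def)
qed

context finite_borel_measure
begin

lemma sets_eq_borel [measurable_cong]: "sets M = sets borel"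
  by (rule M_is_borel)

lemma cdf_le_mass: "cdf M x \<le> measure M UNIV"
  using cdf_bounded borel_UNIV by simp

lemma cdf_split: "cdf M x = measure M {..<x} + measure M {x}"
  unfolding cdf_def ivl_disj_un(2)[symmetric] by (subst finite_measure_Union) auto

lemma mono_measure_lessThan: "x \<le> y \<Longrightarrow> measure M {..<x} \<le> measure M {..<y}"
  by (auto intro!: finite_measure_mono)

lemma cdf_le_measure_lessThan: "x < y \<Longrightarrow> cdf M x \<le> measure M {..<y}"
  unfolding cdf_def by (auto intro!: finite_measure_mono)

lemma measurable_smooth_cdf [measurable]: "smooth_cdf M \<in> borel \<Otimes>\<^sub>M borel \<rightarrow>\<^sub>M borel"
proof -
  have [measurable]: "(\<lambda>x. measure M {..<x}) \<in> borel_measurable borel"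
    by (intro borel_measurable_mono monoI mono_measure_lessThan)
  have [measurable]: "cdf M \<in> borel_measurable borel"
    by (intro borel_measurable_mono monoI cdf_nondecreasing)
  have "smooth_cdf M = (\<lambda>z. measure M {..<fst z} + (cdf M (fst z) - measure M {..<fst z}) * snd z)"
    by (simp add: smooth_cdf_def cdf_split fun_eq_iff)
  then show ?thesis by simp
qed

lemma smooth_cdf_bounds:
  assumes "0 \<le> u" "u \<le> 1"
  shows "measure M {..<x} \<le> smooth_cdf M (x, u)" "smooth_cdf M (x, u) \<le> cdf M x"
  using assms by (auto simp: smooth_cdf_def cdf_split mult_left_le)

text \<open>Right-continuity of \<open>cdf M\<close> makes the infimum in \<open>quantile\<close> a
  minimum, so the two functions form a Galois connection. Later order arguments about quantiles rest
  on this equivalence alone.\<close>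

lemma quantile_le_iff:
  assumes "0 < h" "h < measure M UNIV"
  shows "quantile M h \<le> x \<longleftrightarrow> h \<le> cdf M x"
proof -
  interpret right_continuous_mono "cdf M" 0 "measure M UNIV"
  proof
    show "(cdf M \<longlongrightarrow> measure M UNIV) at_top"
      using cdf_lim_at_top by (simp only: borel_UNIV)
    show "mono (cdf M)" by (intro monoI cdf_nondecreasing)
    show "(cdf M \<longlongrightarrow> 0) at_bot" by (rule cdf_lim_at_bot)
    show "continuous (at_right x) (cdf M)" for x by (rule cdf_is_right_cont)
  qed
  show ?thesis using pseudoinverse[OF assms, of x] assms by (simp add: quantile_def)
qed

lemma sets_smooth_cdf [simp]:
  "{z. smooth_cdf M z < h} \<in> sets (M \<Otimes>\<^sub>M borel)"
  "{z. smooth_cdf M z \<le> h} \<in> sets (M \<Otimes>\<^sub>M borel)"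
  "{z. fst z \<le> t \<and> smooth_cdf M z \<le> h} \<in> sets (M \<Otimes>\<^sub>M borel)"
proof -
  have [simp]: "space (M \<Otimes>\<^sub>M (borel::real measure)) = UNIV"
    by (simp add: space_pair_measure borel_UNIV)
  have "{z \<in> space (M \<Otimes>\<^sub>M borel). smooth_cdf M z < h} \<in> sets (M \<Otimes>\<^sub>M borel)"
    "{z \<in> space (M \<Otimes>\<^sub>M borel). smooth_cdf M z \<le> h} \<in> sets (M \<Otimes>\<^sub>M borel)"
    "{z \<in> space (M \<Otimes>\<^sub>M borel). fst z \<le> t \<and> smooth_cdf M z \<le> h} \<in> sets (M \<Otimes>\<^sub>M borel)"
    by measurable
  then show "{z. smooth_cdf M z < h} \<in> sets (M \<Otimes>\<^sub>M borel)"
    "{z. smooth_cdf M z \<le> h} \<in> sets (M \<Otimes>\<^sub>M borel)"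
    "{z. fst z \<le> t \<and> smooth_cdf M z \<le> h} \<in> sets (M \<Otimes>\<^sub>M borel)"
    by simp_all
qed

lemma sets_pair_unif [measurable_cong]: "sets (M \<Otimes>\<^sub>M unif) = sets (M \<Otimes>\<^sub>M borel)"
  by (intro sets_pair_measure_cong) auto

lemma measurable_quantile [measurable]: "quantile M \<in> borel_measurable borel"
proof -
  \<comment> \<open>The default value 0 outside this interval can destroy monotonicity on the whole
    line, so it is handled as a separate case.\<close>
  have "mono_on {0<..<measure M UNIV} (quantile M)"
  proof (rule mono_onI)
    fix h k assume "h \<in> {0<..<measure M UNIV}" "k \<in> {0<..<measure M UNIV}" "h \<le> k"
    then show "quantile M h \<le> quantile M k"
      using quantile_le_iff[of k "quantile M k"] quantile_le_iff[of h "quantile M k"] by auto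
  qed
  from borel_measurable_mono_on_fnc[OF this]
  have "(\<lambda>h. if h \<in> {0<..<measure M UNIV} then quantile M h else 0) \<in> borel_measurable borel"
    by (intro measurable_If_restrict_space_iff[THEN iffD2]) (auto simp: greaterThanLessThan_def
        greaterThan_def lessThan_def Int_def)
  also have "(\<lambda>h. if h \<in> {0<..<measure M UNIV} then quantile M h else 0) = quantile M"
    by (auto simp: quantile_def fun_eq_iff)
  finally show ?thesis .
qed

text \<open>Let \<open>a\<close> be the quantile of \<open>h\<close>. Points left of
  \<open>a\<close> have levels below \<open>h\<close>, points right of \<open>a\<close> do not, and
  over \<open>a\<close> itself the level is below \<open>h\<close> exactly for \<open>u < c\<close>,
  where \<open>c\<close> is the fraction of the jump at \<open>a\<close> that lies under
  \<open>h\<close>. The mass left of \<open>a\<close> plus \<open>c\<close> times the mass of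
  \<open>a\<close> is \<open>h\<close> by the choice of \<open>c\<close>.\<close>

lemma emeasure_smooth_cdf_less:
  assumes h: "0 < h" "h < measure M UNIV"
  shows "emeasure (M \<Otimes>\<^sub>M unif) {z. smooth_cdf M z < h} = ennreal h"
proof -
  interpret U: prob_space unif by (rule prob_space_unif)
  interpret P: pair_sigma_finite M unif ..
  define a where "a = quantile M h"
  have Q: "a \<le> x \<longleftrightarrow> h \<le> cdf M x" for x
    unfolding a_def by (rule quantile_le_iff[OF h])
  have below: "cdf M x < h" if "x < a" for x
    using that Q[of x] by simp
  have "measure M {..<a} \<le> h"
    by (rule tendsto_upperbound[OF cdf_at_left])
      (auto simp: eventually_at_filter intro!: always_eventually less_imp_le below)
  moreover have "h \<le> measure M {..<a} + measure M {a}"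
    using Q[of a] by (simp add: cdf_split)
  \<comment> \<open>When \<open>a\<close> carries no mass, the two bounds force
    \<open>measure M {..<a} = h\<close> and \<open>c = 0\<close> serves. The alternative recorded in
    \<open>c'\<close> is what permits cancelling the mass of \<open>a\<close> below, where
    \<open>u\<close> is nonnegative.\<close>
  ultimately obtain c where c: "0 \<le> c" "c \<le> 1" "measure M {..<a} + measure M {a} * c = h"
    and c': "measure M {a} > 0 \<or> c = 0"
  proof (cases "measure M {a} = 0")
    case False
    then have pos: "measure M {a} > 0" by (simp add: less_le)
    show ?thesis
      by (rule that[of "(h - measure M {..<a}) / measure M {a}"])
        (use \<open>measure M {..<a} \<le> h\<close> \<open>h \<le> _\<close> pos in \<open>auto simp: field_simps\<close>)
  qed (use that[of 0] in auto)
  have "(AE z in M \<Otimes>\<^sub>M unif. smooth_cdf M z < h \<longleftrightarrow>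
      z \<in> {..<a} \<times> UNIV \<union> {a} \<times> {..<c})"
  proof -
    have meas: "{z \<in> space (M \<Otimes>\<^sub>M unif). (smooth_cdf M z < h) =
        (z \<in> {..<a} \<times> UNIV \<union> {a} \<times> {..<c})} \<in> sets (M \<Otimes>\<^sub>M unif)"
      by measurable
    have "AE x in M. AE u in unif. smooth_cdf M (x, u) < h \<longleftrightarrow>
        (x, u) \<in> {..<a} \<times> UNIV \<union> {a} \<times> {..<c}"
    proof (rule AE_I2)
      fix x
      show "AE u in unif. smooth_cdf M (x, u) < h \<longleftrightarrow>
          (x, u) \<in> {..<a} \<times> UNIV \<union> {a} \<times> {..<c}"
      proof (rule AE_mp[OF AE_unif], rule AE_I2, rule impI)
        fix u :: real assume u: "0 \<le> u \<and> u \<le> 1"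
        consider "x < a" | "x > a" | "x = a" by linarith
        then show "smooth_cdf M (x, u) < h \<longleftrightarrow> (x, u) \<in> {..<a} \<times> UNIV \<union> {a} \<times> {..<c}"
        proof cases
          case 1
          then show ?thesis using below[of x] smooth_cdf_bounds(2)[of u x] u by auto
        next
          case 2
          then have "h \<le> measure M {..<x}"
            using Q[of a] cdf_le_measure_lessThan[of a x] by linarith
          then show ?thesis using 2 smooth_cdf_bounds(1)[of u x] u by auto
        next
          case 3
          have "smooth_cdf M (a, u) < h \<longleftrightarrow> measure M {a} * u < measure M {a} * c"
            using c(3) by (auto simp: smooth_cdf_def)
          also have "\<dots> \<longleftrightarrow> u < c" using c' u by (auto simp: mult_less_cancel_left)
          finally show ?thesis using 3 by auto
        qed
      qed
    qed
    with meas show ?thesis by (intro P.AE_pair_measure)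
  qed
  then have "emeasure (M \<Otimes>\<^sub>M unif) {z. smooth_cdf M z < h} =
      emeasure (M \<Otimes>\<^sub>M unif) ({..<a} \<times> UNIV \<union> {a} \<times> {..<c})"
    by (intro emeasure_eq_AE) auto
  also have "\<dots> = emeasure (M \<Otimes>\<^sub>M unif) ({..<a} \<times> UNIV) + emeasure (M \<Otimes>\<^sub>M unif) ({a} \<times> {..<c})"
    by (rule plus_emeasure[symmetric]) auto
  also have "\<dots> = emeasure M {..<a} * 1 + emeasure M {a} * ennreal c"
  proof -
    have "emeasure unif UNIV = 1" using U.emeasure_space_1 by simp
    then show ?thesis
      by (subst (1 2) U.emeasure_pair_measure_Times)
        (simp_all only: emeasure_unif_lessThan[OF c(1,2)], auto)
  qed
  also have "\<dots> = ennreal h"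
    using c by (simp add: emeasure_eq_measure flip: ennreal_mult'' ennreal_plus)
  finally show ?thesis .
qed

text \<open>The closed quadrants in \<open>distr_smooth_cdf\<close> need levels up to and including
  \<open>h\<close>. Strict levels \<open>k\<close> slightly above \<open>h\<close> give the upper
  bound, so no single level carries mass; this also covers \<open>h = 0\<close>, which the strict
  version excludes.\<close>

lemma emeasure_smooth_cdf_le:
  assumes h: "0 \<le> h" "h < measure M UNIV"
  shows "emeasure (M \<Otimes>\<^sub>M unif) {z. smooth_cdf M z \<le> h} = ennreal h"
proof (rule antisym)
  show "emeasure (M \<Otimes>\<^sub>M unif) {z. smooth_cdf M z \<le> h} \<le> ennreal h"
  proof (rule ennreal_le_epsilon)
    fix e :: real assume "0 < e"
    obtain k where k: "h < k" "k < measure M UNIV" "k \<le> h + e"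
      using dense[of h "min (measure M UNIV) (h + e)"] h \<open>0 < e\<close> by auto
    have "emeasure (M \<Otimes>\<^sub>M unif) {z. smooth_cdf M z \<le> h} \<le>
        emeasure (M \<Otimes>\<^sub>M unif) {z. smooth_cdf M z < k}"
      using k by (intro emeasure_mono) auto
    also have "\<dots> = ennreal k" using h k by (intro emeasure_smooth_cdf_less) auto
    also have "\<dots> \<le> ennreal h + ennreal e"
      using k h \<open>0 < e\<close> by (simp flip: ennreal_plus)
    finally show "emeasure (M \<Otimes>\<^sub>M unif) {z. smooth_cdf M z \<le> h} \<le> ennreal h + ennreal e" .
  qed
  show "ennreal h \<le> emeasure (M \<Otimes>\<^sub>M unif) {z. smooth_cdf M z \<le> h}"
  proof (cases "h = 0")
    case False
    then have "ennreal h = emeasure (M \<Otimes>\<^sub>M unif) {z. smooth_cdf M z < h}"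
      using h by (intro emeasure_smooth_cdf_less[symmetric]) auto
    also have "\<dots> \<le> emeasure (M \<Otimes>\<^sub>M unif) {z. smooth_cdf M z \<le> h}"
      by (intro emeasure_mono) auto
    finally show ?thesis .
  qed simp
qed

text \<open>
  The randomised probability integral transform: both sides describe a pair of a point with
  distribution \<open>M\<close> and its level, which is uniform on \<open>(0, M(UNIV))\<close>.
\<close>

lemma distr_smooth_cdf:
  "distr (M \<Otimes>\<^sub>M unif) borel (\<lambda>z. (fst z, smooth_cdf M z)) =
   distr (restrict_space lborel {0<..<measure M UNIV}) borel (\<lambda>h. (quantile M h, h))"
  (is "?A = ?B")
proof (rule measure_eqI_generator_eq[where \<Omega> = UNIV and E = "range atMost" and
      A = "\<lambda>n. {..(real n, real n)}"])
  interpret U: prob_space unif by (rule prob_space_unif)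
  interpret P: pair_sigma_finite M unif ..
  interpret MU: finite_measure "M \<Otimes>\<^sub>M unif"
    by (rule finite_measure_pair_measure) unfold_locales
  let ?m = "measure M UNIV"
  show "Int_stable (range atMost :: (real \<times> real) set set)"
  proof (rule Int_stableI_image)
    fix i j :: "real \<times> real"
    show "\<exists>k\<in>UNIV. {..i} \<inter> {..j} = {..k}"
      by (rule bexI[of _ "inf i j"]) (auto simp: le_inf_iff)
  qed
  show "sets ?A = sigma_sets UNIV (range atMost)" "sets ?B = sigma_sets UNIV (range atMost)"
    by (simp_all add: borel_eq_atMost[where 'a = "real \<times> real"])
  show "(\<Union>n. {..(real n, real n)}) = UNIV"
  proof safe
    fix a b :: real
    obtain n where "max a b \<le> real n" using real_arch_simple by blast
    then show "(a, b) \<in> (\<Union>n. {..(real n, real n)})" by (auto simp: less_eq_prod_def)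
  qed auto
  show "emeasure ?A {..(real n, real n)} \<noteq> \<infinity>" for n
    by (subst emeasure_distr) (auto simp: MU.emeasure_eq_measure)
  fix Z :: "(real \<times> real) set" assume "Z \<in> range atMost"
  then obtain t h where Z: "Z = {..(t, h)}" by auto
  have "emeasure ?A Z = emeasure (M \<Otimes>\<^sub>M unif) {z. fst z \<le> t \<and> smooth_cdf M z \<le> h}"
    by (subst emeasure_distr)
      (auto simp: Z less_eq_prod_def space_pair_measure borel_UNIV intro!: arg_cong2[where f=emeasure])
  \<comment> \<open>Levels respect the order of the points: almost surely a point in
    \<open>{..t}\<close> has level at most \<open>cdf M t\<close>, and a point beyond
    \<open>t\<close> at least that. So one of the two constraints always implies the other. For
    \<open>h < 0\<close> the value is 0 because \<open>ennreal\<close> truncates.\<close>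
  also have "\<dots> = ennreal (min h (cdf M t))"
  proof -
    have AEU: "AE z in M \<Otimes>\<^sub>M unif. 0 \<le> snd z \<and> snd z \<le> 1"
    proof (rule P.AE_pair_measure)
      show "AE x in M. AE u in unif. 0 \<le> snd (x, u) \<and> snd (x, u) \<le> 1"
        using AE_unif by simp
    qed measurable
    consider "cdf M t \<le> h" | "h < 0" "h < cdf M t" | "0 \<le> h" "h < cdf M t" by linarith
    then show ?thesis
    proof cases
      case 1
      have "emeasure (M \<Otimes>\<^sub>M unif) {z. fst z \<le> t \<and> smooth_cdf M z \<le> h} =
          emeasure (M \<Otimes>\<^sub>M unif) ({..t} \<times> UNIV)"
      proof (rule emeasure_eq_AE)
        show "AE z in M \<Otimes>\<^sub>M unif. z \<in> {z. fst z \<le> t \<and> smooth_cdf M z \<le> h} \<longleftrightarrow> z \<in> {..t} \<times> UNIV"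
        proof (rule AE_mp[OF AEU], rule AE_I2, rule impI)
          fix z :: "real \<times> real" assume z: "0 \<le> snd z \<and> snd z \<le> 1"
          have "smooth_cdf M z \<le> h" if "fst z \<le> t"
            using smooth_cdf_bounds(2)[of "snd z" "fst z"] cdf_nondecreasing[OF that] z 1 by auto
          then show "z \<in> {z. fst z \<le> t \<and> smooth_cdf M z \<le> h} \<longleftrightarrow> z \<in> {..t} \<times> UNIV"
            by (cases z) auto
        qed
      qed auto
      also have "\<dots> = ennreal (cdf M t)"
        using U.emeasure_space_1
        by (subst U.emeasure_pair_measure_Times) (auto simp: emeasure_eq_measure cdf_def)
      finally show ?thesis using 1 by (simp add: min_def)
    next
      case 2
      have "emeasure (M \<Otimes>\<^sub>M unif) {z. fst z \<le> t \<and> smooth_cdf M z \<le> h} = emeasure (M \<Otimes>\<^sub>M unif) {}"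
      proof (rule emeasure_eq_AE)
        show "AE z in M \<Otimes>\<^sub>M unif. z \<in> {z. fst z \<le> t \<and> smooth_cdf M z \<le> h} \<longleftrightarrow> z \<in> {}"
        proof (rule AE_mp[OF AEU], rule AE_I2, rule impI)
          fix z :: "real \<times> real" assume z: "0 \<le> snd z \<and> snd z \<le> 1"
          have "0 \<le> smooth_cdf M z"
            using z by (auto simp: smooth_cdf_def)
          then show "z \<in> {z. fst z \<le> t \<and> smooth_cdf M z \<le> h} \<longleftrightarrow> z \<in> {}" using 2 by auto
        qed
      qed auto
      then show ?thesis using 2 by (simp add: min_def ennreal_neg)
    next
      case 3
      have "emeasure (M \<Otimes>\<^sub>M unif) {z. fst z \<le> t \<and> smooth_cdf M z \<le> h} =
          emeasure (M \<Otimes>\<^sub>M unif) {z. smooth_cdf M z \<le> h}"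
      proof (rule emeasure_eq_AE)
        show "AE z in M \<Otimes>\<^sub>M unif. z \<in> {z. fst z \<le> t \<and> smooth_cdf M z \<le> h} \<longleftrightarrow>
            z \<in> {z. smooth_cdf M z \<le> h}"
        proof (rule AE_mp[OF AEU], rule AE_I2, rule impI)
          fix z :: "real \<times> real" assume z: "0 \<le> snd z \<and> snd z \<le> 1"
          have "h < smooth_cdf M z" if "t < fst z"
            using smooth_cdf_bounds(1)[of "snd z" "fst z"] cdf_le_measure_lessThan[OF that] z 3 by auto
          then show "z \<in> {z. fst z \<le> t \<and> smooth_cdf M z \<le> h} \<longleftrightarrow> z \<in> {z. smooth_cdf M z \<le> h}"
            by force
        qed
      qed auto
      also have "\<dots> = ennreal h"
        using 3 cdf_le_mass[of t] by (intro emeasure_smooth_cdf_le) auto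
      finally show ?thesis using 3 by (simp add: min_def)
    qed
  qed
  also have "\<dots> = emeasure lborel ({0<..<?m} \<inter> {..min h (cdf M t)})"
  proof -
    \<comment> \<open>If \<open>min h (cdf M t)\<close> equals \<open>?m\<close>, the two sets
      differ in that one point, since the interval of levels is open at its end.\<close>
    have "emeasure lborel ({0<..<?m} \<inter> {..min h (cdf M t)}) = emeasure lborel {0<..min h (cdf M t)}"
    proof (rule emeasure_eq_AE)
      show "AE x in lborel. x \<in> {0<..<?m} \<inter> {..min h (cdf M t)} \<longleftrightarrow> x \<in> {0<..min h (cdf M t)}"
        by (rule AE_mp[OF AE_lborel_singleton[of ?m]])
          (use cdf_le_mass[of t] in \<open>auto intro!: AE_I2\<close>)
    qed auto
    also have "\<dots> = ennreal (min h (cdf M t))"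
      by (cases "0 \<le> min h (cdf M t)") (auto simp: ennreal_neg)
    finally show ?thesis by simp
  qed
  also have "{0<..<?m} \<inter> {..min h (cdf M t)} = {k \<in> {0<..<?m}. quantile M k \<le> t \<and> k \<le> h}"
    by (auto simp: quantile_le_iff)
  also have "emeasure lborel \<dots> = emeasure ?B Z"
    by (subst emeasure_distr)
      (auto simp: Z less_eq_prod_def space_restrict_space emeasure_restrict_space
        intro!: measurable_restrict_space1 arg_cong2[where f=emeasure])
  finally show "emeasure ?A Z = emeasure ?B Z" .
qed auto

end

section \<open>The reciprocating function of a centred distribution\<close>

text \<open>\<open>ennreal\<close> sends negative reals to 0, so this is the measure x^+ \<mu>(dx).
  Its mass is the mean of the positive part, and its \<open>cdf\<close> is the level function on the
  positive half-line.\<close>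

definition pos_moment :: "real measure \<Rightarrow> real measure" where
  "pos_moment \<mu> = density \<mu> (\<lambda>x. ennreal x)"

text \<open>Reflection lets facts about the negative half-line be read off from the positive
  half-line of another centred law.\<close>

definition reflect :: "real measure \<Rightarrow> real measure" where
  "reflect \<mu> = distr \<mu> borel uminus"

text \<open>
  A Borel version of the reciprocating function with real values everywhere; it agrees with
  \<open>reciprocating\<close> almost everywhere only, see \<open>AE_reciprocating\<close> below.
\<close>

definition recip_real :: "real measure \<Rightarrow> real \<times> real \<Rightarrow> real" where
  "recip_real \<mu> z =
    (if 0 < fst z then - quantile (pos_moment (reflect \<mu>)) (smooth_cdf (pos_moment \<mu>) z)
     else if fst z < 0
     then quantile (pos_moment \<mu>) (smooth_cdf (pos_moment (reflect \<mu>)) (- fst z, snd z))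
     else 0)"

locale centered_distribution = prob_space \<mu> for \<mu> :: "real measure" +
  assumes sets_borel [simp, measurable_cong]: "sets \<mu> = sets borel"
    and integrable_id: "integrable \<mu> (\<lambda>x. x)"
    and mean_zero: "(\<integral>x. x \<partial>\<mu>) = 0"
begin

lemma space_UNIV [simp]: "space \<mu> = UNIV"
  using sets_eq_imp_space_eq[OF sets_borel] by simp

lemma emeasure_pos_moment:
  "A \<in> sets borel \<Longrightarrow> emeasure (pos_moment \<mu>) A = (\<integral>\<^sup>+z\<in>A. ennreal z \<partial>\<mu>)"
  by (simp add: pos_moment_def emeasure_density)

sublocale pos: finite_borel_measure "pos_moment \<mu>"
proof (intro finite_borel_measure.intro finite_measureI finite_borel_measure_axioms.intro)
  have "(\<integral>\<^sup>+z. ennreal z \<partial>\<mu>) \<le> (\<integral>\<^sup>+z. ennreal (norm z) \<partial>\<mu>)"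
    by (intro nn_integral_mono ennreal_leI) auto
  also have "\<dots> < \<infinity>" using integrable_id by (simp add: integrable_iff_bounded)
  finally show "emeasure (pos_moment \<mu>) (space (pos_moment \<mu>)) \<noteq> \<infinity>"
    by (simp add: pos_moment_def emeasure_density)
qed (simp add: pos_moment_def)

lemma measure_pos_moment_UNIV: "ennreal (measure (pos_moment \<mu>) UNIV) = (\<integral>\<^sup>+z. ennreal z \<partial>\<mu>)"
  by (simp add: emeasure_pos_moment flip: pos.emeasure_eq_measure)

lemma centered_reflect: "centered_distribution (reflect \<mu>)"
proof -
  have m: "uminus \<in> borel_measurable \<mu>" by measurable
  have p: "prob_space (reflect \<mu>)" unfolding reflect_def using m by (rule prob_space_distr)
  have i: "integrable (reflect \<mu>) (\<lambda>x. x)"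
    unfolding reflect_def integrable_distr_eq[OF m measurable_ident_sets[OF refl]]
    by (rule Bochner_Integration.integrable_minus[OF integrable_id])
  have z: "(\<integral>x. x \<partial>reflect \<mu>) = 0"
    unfolding reflect_def integral_distr[OF m measurable_ident_sets[OF refl]]
    by (simp only: integral_minus mean_zero neg_equal_zero minus_zero)
  show ?thesis
  proof (intro centered_distribution.intro centered_distribution_axioms.intro p i z)
  qed (simp add: reflect_def)
qed

text \<open>The zero mean enters here: the positive and the negative part have the same expectation,
  so the levels seen from either side fill the same interval and can be matched.\<close>

lemma mass_reflect: "measure (pos_moment (reflect \<mu>)) UNIV = measure (pos_moment \<mu>) UNIV"
proof -
  interpret R: centered_distribution "reflect \<mu>" by (rule centered_reflect)
  have "(\<integral>\<^sup>+z. ennreal z \<partial>\<mu>) = (\<integral>\<^sup>+z. ennreal (- z) \<partial>\<mu>)"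
  proof -
    have "enn2real (\<integral>\<^sup>+z. ennreal z \<partial>\<mu>) - enn2real (\<integral>\<^sup>+z. ennreal (- z) \<partial>\<mu>) = 0"
      using mean_zero by (subst (asm) real_lebesgue_integral_def[OF integrable_id])
    moreover have "(\<integral>\<^sup>+z. ennreal z \<partial>\<mu>) \<noteq> \<infinity>" "(\<integral>\<^sup>+z. ennreal (- z) \<partial>\<mu>) \<noteq> \<infinity>"
      using integrable_id by (auto simp: real_integrable_def)
    ultimately show ?thesis
      by (metis ennreal_enn2real_if eq_iff_diff_eq_0 infinity_ennreal_def)
  qed
  also have "\<dots> = (\<integral>\<^sup>+z. ennreal z \<partial>reflect \<mu>)"
    by (simp add: reflect_def nn_integral_distr)
  finally show ?thesis
    unfolding measure_pos_moment_UNIV[symmetric] R.measure_pos_moment_UNIV[symmetric]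
    by (simp add: measure_nonneg)
qed

lemma pos_moment_nonpos:
  assumes "A \<in> sets borel" "A \<subseteq> {..0}"
  shows "measure (pos_moment \<mu>) A = 0"
proof -
  have "emeasure (pos_moment \<mu>) A = (\<integral>\<^sup>+z. 0 \<partial>\<mu>)"
    using assms unfolding emeasure_pos_moment[OF assms(1)]
    by (intro nn_integral_cong) (auto simp: indicator_def ennreal_neg)
  then show ?thesis by (simp add: measure_def)
qed

section \<open>The level function and its two inverses as distribution functions and
  quantiles\<close>

lemma recip_G_real:
  assumes "0 \<le> y"
  shows "recip_G \<mu> (ereal y) = ereal (cdf (pos_moment \<mu>) y)"
proof -
  have "(\<integral>\<^sup>+z\<in>{z. 0 < z \<and> z \<le> y}. ennreal z \<partial>\<mu>) = emeasure (pos_moment \<mu>) {..y}"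
    unfolding emeasure_pos_moment[OF atMost_borel]
    by (intro nn_integral_cong) (auto simp: indicator_def ennreal_neg)
  then show ?thesis
    using assms
    by (simp add: recip_G_def cdf_def pos.emeasure_eq_measure enn2ereal_ennreal)
qed

lemma recip_G_PInf: "recip_G \<mu> \<infinity> = ereal (measure (pos_moment \<mu>) UNIV)"
proof -
  have "(\<integral>\<^sup>+z\<in>{z. 0 < z}. ennreal z \<partial>\<mu>) = emeasure (pos_moment \<mu>) UNIV"
    unfolding emeasure_pos_moment[OF sets.top[of borel, unfolded space_borel]]
    by (intro nn_integral_cong) (auto simp: indicator_def ennreal_neg)
  then show ?thesis
    by (simp add: recip_G_def pos.emeasure_eq_measure enn2ereal_ennreal)
qed

lemma recip_G_nonpos:
  assumes "x \<le> 0"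
  shows "recip_G \<mu> x = recip_G (reflect \<mu>) (- x)"
\<comment> \<open>At 0 both sides use the nonnegative branch of \<open>recip_G\<close> and integrate
  over the empty set; for \<open>x < 0\<close> they use different branches.\<close>
proof (cases "x = 0")
  case False
  have [measurable]: "{z. 0 < z \<and> ereal z \<le> - x} \<in> sets borel"
    by measurable
  have "(\<integral>\<^sup>+z\<in>{z. x \<le> ereal z \<and> z < 0}. ennreal (- z) \<partial>\<mu>) =
      (\<integral>\<^sup>+z\<in>{z. 0 < z \<and> ereal z \<le> - x}. ennreal z \<partial>reflect \<mu>)"
    unfolding reflect_def
    by (subst nn_integral_distr)
      (auto simp: indicator_def ereal_uminus_le_reorder ereal_minus_le_minus
        simp flip: uminus_ereal.simps intro!: nn_integral_cong)
  moreover have "\<not> 0 \<le> x" "0 \<le> - x" using assms False by (auto simp: ereal_uminus_le_reorder)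
  ultimately show ?thesis by (simp add: recip_G_def)
qed (simp add: recip_G_def)

text \<open>The set under the infimum is the closed ray from the quantile upwards. Since
  \<open>h > 0\<close>, the quantile is nonnegative and the constraint \<open>0 \<le> x\<close>
  removes nothing; since \<open>h\<close> is below the total mass, \<open>\<infinity>\<close>
  belongs to the set.\<close>

lemma recip_x_plus_eq:
  assumes "0 < h" "h < measure (pos_moment \<mu>) UNIV"
  shows "recip_x_plus \<mu> (ereal h) = ereal (quantile (pos_moment \<mu>) h)"
proof -
  have Q: "quantile (pos_moment \<mu>) h \<le> x \<longleftrightarrow> h \<le> cdf (pos_moment \<mu>) x" for x
    by (rule pos.quantile_le_iff[OF assms])
  have "0 \<le> quantile (pos_moment \<mu>) h"
    using Q[of 0] assms(1) pos_moment_nonpos[of "{..0}"] by (simp add: cdf_def)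
  have "0 \<le> x \<and> ereal h \<le> recip_G \<mu> x \<longleftrightarrow> ereal (quantile (pos_moment \<mu>) h) \<le> x" for x
  proof (cases x)
    case (real r)
    then show ?thesis using Q[of r] \<open>0 \<le> quantile _ h\<close> by (auto simp: recip_G_real)
  qed (use assms in \<open>auto simp: recip_G_PInf\<close>)
  then have "{x. 0 \<le> x \<and> ereal h \<le> recip_G \<mu> x} = {ereal (quantile (pos_moment \<mu>) h)..}"
    by auto
  then show ?thesis by (simp add: recip_x_plus_def)
qed

lemma recip_x_minus_eq: "recip_x_minus \<mu> h = - recip_x_plus (reflect \<mu>) h"
proof -
  have "{x. x \<le> 0 \<and> h \<le> recip_G \<mu> x} = uminus ` {x. 0 \<le> x \<and> h \<le> recip_G (reflect \<mu>) x}"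
  proof safe
    fix x :: ereal assume "x \<le> 0" "h \<le> recip_G \<mu> x"
    then show "x \<in> uminus ` {x. 0 \<le> x \<and> h \<le> recip_G (reflect \<mu>) x}"
      by (intro image_eqI[where x = "- x"]) (auto simp: recip_G_nonpos ereal_uminus_le_reorder)
  next
    fix x :: ereal assume x: "0 \<le> x" "h \<le> recip_G (reflect \<mu>) x"
    then show "- x \<le> 0" by (simp add: ereal_uminus_le_reorder)
    with x(2) show "h \<le> recip_G \<mu> (- x)" by (simp add: recip_G_nonpos)
  qed
  then show ?thesis
    by (simp add: recip_x_minus_def recip_x_plus_def ereal_Sup_uminus_image_eq)
qed

lemma tendsto_recip_G_at_left:
  assumes "0 < x"
  shows "((\<lambda>y. recip_G \<mu> (ereal y)) \<longlongrightarrow> ereal (measure (pos_moment \<mu>) {..<x})) (at_left x)"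
proof (rule Lim_transform_eventually)
  show "((\<lambda>y. ereal (cdf (pos_moment \<mu>) y)) \<longlongrightarrow> ereal (measure (pos_moment \<mu>) {..<x})) (at_left x)"
    by (intro tendsto_ereal pos.cdf_at_left)
  show "\<forall>\<^sub>F y in at_left x. ereal (cdf (pos_moment \<mu>) y) = recip_G \<mu> (ereal y)"
    using eventually_at_left_real[OF assms]
    by eventually_elim (simp add: recip_G_real)
qed

lemma tendsto_recip_G_at_right:
  assumes "x < 0"
  shows "((\<lambda>y. recip_G \<mu> (ereal y)) \<longlongrightarrow>
    ereal (measure (pos_moment (reflect \<mu>)) {..<- x})) (at_right x)"
proof -
  interpret R: centered_distribution "reflect \<mu>" by (rule centered_reflect)
  have "((\<lambda>y. recip_G \<mu> (ereal (- y))) \<longlongrightarrow>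
      ereal (measure (pos_moment (reflect \<mu>)) {..<- x})) (at_left (- x))"
  proof (rule Lim_transform_eventually)
    show "\<forall>\<^sub>F y in at_left (- x). recip_G (reflect \<mu>) (ereal y) = recip_G \<mu> (ereal (- y))"
      using eventually_at_left_real[of 0 "- x"] assms
      by (auto elim!: eventually_mono simp: recip_G_nonpos)
  qed (use R.tendsto_recip_G_at_left[of "- x"] assms in simp)
  then show ?thesis
    by (simp add: at_right_minus[of x] filterlim_filtermap)
qed

text \<open>At 0 \<open>recip_G_tilde\<close> takes the left limit, which runs through the negative
  half-line. There the level function is a reflected distribution function, right-continuous at 0
  with value 0.\<close>

lemma Lim_recip_G_at_left_0: "Lim (at_left 0) (recip_G \<mu>) = 0"
proof -
  interpret R: centered_distribution "reflect \<mu>" by (rule centered_reflect)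
  have "((\<lambda>y. cdf (pos_moment (reflect \<mu>)) y) \<longlongrightarrow> cdf (pos_moment (reflect \<mu>)) 0) (at_right 0)"
    using R.pos.cdf_is_right_cont by (simp add: continuous_within)
  also have "cdf (pos_moment (reflect \<mu>)) 0 = 0"
    by (simp add: cdf_def R.pos_moment_nonpos)
  finally have "((\<lambda>y. ereal (cdf (pos_moment (reflect \<mu>)) (- y))) \<longlongrightarrow> ereal 0) (at_left 0)"
    by (intro tendsto_ereal) (simp add: at_left_minus[of 0] filterlim_filtermap)
  then have "((\<lambda>y. recip_G \<mu> (ereal y)) \<longlongrightarrow> ereal 0) (at_left 0)"
  proof (rule Lim_transform_eventually)
    show "\<forall>\<^sub>F y in at_left 0. ereal (cdf (pos_moment (reflect \<mu>)) (- y)) = recip_G \<mu> (ereal y)"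
      using eventually_at_left_real[of "- 1" 0]
      by (auto elim!: eventually_mono simp: recip_G_nonpos R.recip_G_real)
  qed
  then show ?thesis
    unfolding zero_ereal_def at_left_ereal
    by (intro tendsto_Lim) (auto simp: filterlim_filtermap at_left_ereal filtermap_bot_iff)
qed

lemma recip_G_tilde_pos:
  assumes "0 < x"
  shows "recip_G_tilde \<mu> (ereal x) u = ereal (smooth_cdf (pos_moment \<mu>) (x, u))"
proof -
  have "Lim (at_left (ereal x)) (recip_G \<mu>) = ereal (measure (pos_moment \<mu>) {..<x})"
    using tendsto_recip_G_at_left[OF assms]
    by (intro tendsto_Lim) (auto simp: filterlim_filtermap at_left_ereal filtermap_bot_iff)
  then show ?thesis
    using assms by (simp add: recip_G_tilde_def recip_G_real pos.cdf_split smooth_cdf_def)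
qed

lemma recip_G_tilde_neg:
  assumes "x < 0"
  shows "recip_G_tilde \<mu> (ereal x) u = ereal (smooth_cdf (pos_moment (reflect \<mu>)) (- x, u))"
proof -
  interpret R: centered_distribution "reflect \<mu>" by (rule centered_reflect)
  have "Lim (at_right (ereal x)) (recip_G \<mu>) = ereal (measure (pos_moment (reflect \<mu>)) {..<- x})"
    using tendsto_recip_G_at_right[OF assms]
    by (intro tendsto_Lim) (auto simp: filterlim_filtermap at_right_ereal filtermap_bot_iff)
  then show ?thesis
    using assms
    by (simp add: recip_G_tilde_def recip_G_nonpos R.recip_G_real R.pos.cdf_split smooth_cdf_def)
qed

lemma reciprocating_0: "reciprocating \<mu> 0 u = 0"
proof -
  have G0: "recip_G \<mu> 0 = 0" by (simp add: recip_G_def zero_ennreal.rep_eq)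
  have "recip_G_tilde \<mu> 0 u = 0"
    by (simp add: recip_G_tilde_def Lim_recip_G_at_left_0 G0)
  moreover have "recip_x_minus \<mu> 0 = 0"
    unfolding recip_x_minus_def by (rule Sup_eqI) (auto simp: G0)
  ultimately show ?thesis by (simp add: reciprocating_def)
qed

text \<open>At the full mass the extended inverse can be infinite or a nonzero end point of the
  support, while \<open>quantile\<close> returns its default 0. By \<open>AE_smooth_cdf\<close> and
  \<open>AE_smooth_cdf_reflect\<close> almost every nonzero point has an interior level.\<close>

lemma reciprocating_eq:
  assumes "0 < x \<Longrightarrow> smooth_cdf (pos_moment \<mu>) (x, u) \<in> {0<..<measure (pos_moment \<mu>) UNIV}"
    and "x < 0 \<Longrightarrow> smooth_cdf (pos_moment (reflect \<mu>)) (- x, u) \<in> {0<..<measure (pos_moment \<mu>) UNIV}"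
  shows "reciprocating \<mu> (ereal x) u = ereal (recip_real \<mu> (x, u))"
proof -
  interpret R: centered_distribution "reflect \<mu>" by (rule centered_reflect)
  consider "0 < x" | "x < 0" | "x = 0" by linarith
  then show ?thesis
  proof cases
    case 1
    with assms(1) show ?thesis
      by (simp add: reciprocating_def recip_G_tilde_pos recip_x_minus_eq R.recip_x_plus_eq
          mass_reflect recip_real_def)
  next
    case 2
    with assms(2) show ?thesis
      by (simp add: reciprocating_def recip_G_tilde_neg recip_x_plus_eq recip_real_def)
  next
    case 3
    then show ?thesis using reciprocating_0 by (simp add: recip_real_def zero_ereal_def)
  qed
qed

lemma quantile_pos:
  assumes "h \<in> {0<..<measure (pos_moment \<mu>) UNIV}"
  shows "0 < quantile (pos_moment \<mu>) h"
  using pos.quantile_le_iff[of h 0] assms pos_moment_nonpos[of "{..0}"]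
  by (auto simp: cdf_def not_le[symmetric])

end

section \<open>Two-point disintegration in one dimension\<close>

lemma sets_borel_pair [measurable_cong]:
  "sets (borel :: (real \<times> real) measure) = sets (borel \<Otimes>\<^sub>M borel)"
  unfolding borel_prod ..

text \<open>
  The law of the paper's pair \<open>(X, R)\<close> for the two-point variable with values \<open>x\<close> and \<open>r\<close>: since
  \<open>R = x r / X\<close>, it is carried by \<open>(x, r)\<close> and \<open>(r, x)\<close>, with the weights that make the mean zero.
  In the degenerate case \<open>q = (0, 0)\<close> the weight is the junk value \<open>0 / 0 = 0\<close>, which is harmless.
\<close>

definition two_point_kernel :: "real \<times> real \<Rightarrow> (real \<times> real) measure" where
  "two_point_kernel p =
    (let q = if fst p * snd p < 0 then p else (0, 0)
     in distr (measure_pmf (bernoulli_pmf (\<bar>snd q\<bar> / (\<bar>fst q\<bar> + \<bar>snd q\<bar>)))) borel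
          (\<lambda>b. if b then q else prod.swap q))"

lemma nn_integral_two_point_kernel:
  assumes [measurable]: "f \<in> borel_measurable borel"
  shows "(\<integral>\<^sup>+y. f y \<partial>two_point_kernel (x, r)) =
    (if x * r < 0 then ennreal (\<bar>r\<bar> / (\<bar>x\<bar> + \<bar>r\<bar>)) * f (x, r) + ennreal (\<bar>x\<bar> / (\<bar>x\<bar> + \<bar>r\<bar>)) * f (r, x)
     else f (0, 0))"
proof -
  have "1 - \<bar>r\<bar> / (\<bar>x\<bar> + \<bar>r\<bar>) = \<bar>x\<bar> / (\<bar>x\<bar> + \<bar>r\<bar>)" if "x * r < 0"
  proof -
    have "x \<noteq> 0" using that by auto
    then have "\<bar>x\<bar> + \<bar>r\<bar> \<noteq> 0" by linarith
    then show ?thesis by (simp add: field_simps)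
  qed
  moreover have "\<bar>r\<bar> / (\<bar>x\<bar> + \<bar>r\<bar>) \<le> 1"
    by (cases "\<bar>x\<bar> + \<bar>r\<bar> = 0") (auto simp: divide_le_eq_1)
  ultimately show ?thesis
    by (simp add: two_point_kernel_def Let_def nn_integral_distr mult.commute)
qed

lemma sets_two_point_kernel [simp, measurable_cong]: "sets (two_point_kernel p) = sets borel"
  by (simp add: two_point_kernel_def Let_def)

lemma prob_space_two_point_kernel: "prob_space (two_point_kernel p)"
  unfolding two_point_kernel_def Let_def
  by (intro prob_space.prob_space_distr measure_pmf.prob_space_axioms) simp

lemma emeasure_two_point_kernel:
  assumes "A \<in> sets borel"
  shows "emeasure (two_point_kernel (x, r)) A =
    (if x * r < 0 then ennreal (\<bar>r\<bar> / (\<bar>x\<bar> + \<bar>r\<bar>)) * indicator A (x, r) +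
      ennreal (\<bar>x\<bar> / (\<bar>x\<bar> + \<bar>r\<bar>)) * indicator A (r, x) else indicator A (0, 0))"
  using nn_integral_two_point_kernel[of "indicator A" x r] assms by simp

lemma measurable_two_point_kernel [measurable]:
  "two_point_kernel \<in> borel \<rightarrow>\<^sub>M prob_algebra borel"
proof (rule measurable_prob_algebra_generated[of borel UNIV "sets borel"])
  fix A :: "(real \<times> real) set" assume [measurable]: "A \<in> sets borel"
  have "(\<lambda>p. emeasure (two_point_kernel p) A) =
    (\<lambda>p. if fst p * snd p < 0
      then ennreal (\<bar>snd p\<bar> / (\<bar>fst p\<bar> + \<bar>snd p\<bar>)) * indicator A (fst p, snd p) +
        ennreal (\<bar>fst p\<bar> / (\<bar>fst p\<bar> + \<bar>snd p\<bar>)) * indicator A (snd p, fst p)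
      else indicator A (0, 0))"
    by (auto simp: fun_eq_iff emeasure_two_point_kernel)
  also have "\<dots> \<in> borel_measurable borel" by measurable
  finally show "(\<lambda>p. emeasure (two_point_kernel p) A) \<in> borel_measurable borel" .
next
  show "sets borel = sigma_sets UNIV (sets (borel :: (real \<times> real) measure))"
    using sets.sigma_sets_eq[of "borel :: (real \<times> real) measure"] by simp
qed (auto simp: prob_space_two_point_kernel Int_stable_def)

context centered_distribution
begin

lemma measurable_recip_real [measurable]: "recip_real \<mu> \<in> borel_measurable (borel \<Otimes>\<^sub>M borel)"
proof -
  interpret R: centered_distribution "reflect \<mu>" by (rule centered_reflect)
  show ?thesis unfolding recip_real_def by measurable
qed

lemma pair_pos_moment:
  "pos_moment \<mu> \<Otimes>\<^sub>M unif = density (\<mu> \<Otimes>\<^sub>M unif) (\<lambda>z. ennreal (fst z))"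
proof -
  have "density \<mu> (\<lambda>x. ennreal x) \<Otimes>\<^sub>M density unif (\<lambda>_. 1) =
      density (\<mu> \<Otimes>\<^sub>M unif) (\<lambda>(x, u). ennreal x * 1)"
    by (rule pair_measure_density) (use sigma_finite_unif in \<open>simp_all add: density_1\<close>)
  then show ?thesis by (simp add: density_1 pos_moment_def case_prod_unfold)
qed

lemma pair_reflect:
  "reflect \<mu> \<Otimes>\<^sub>M unif = distr (\<mu> \<Otimes>\<^sub>M unif) (borel \<Otimes>\<^sub>M borel) (\<lambda>z. (- fst z, snd z))"
proof -
  have [simp]: "distr unif borel (\<lambda>u. u) = unif" by (rule distr_id2) simp
  have "distr \<mu> borel uminus \<Otimes>\<^sub>M distr unif borel (\<lambda>u. u) =
      distr (\<mu> \<Otimes>\<^sub>M unif) (borel \<Otimes>\<^sub>M borel) (\<lambda>(x, u). (- x, u))"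
    by (rule pair_measure_distr) (use sigma_finite_unif in simp_all)
  then show ?thesis by (simp add: reflect_def case_prod_unfold)
qed

text \<open>By \<open>distr_smooth_cdf\<close> the level under the weighted measure has Lebesgue
  measure on the open interval as its law, so the end levels are negligible. Removing the weight
  \<open>ennreal (fst z)\<close> leaves a statement about points with
  \<open>0 < fst z\<close>.\<close>

lemma AE_smooth_cdf:
  "AE z in \<mu> \<Otimes>\<^sub>M unif. 0 < fst z \<longrightarrow>
    smooth_cdf (pos_moment \<mu>) z \<in> {0<..<measure (pos_moment \<mu>) UNIV}"
proof -
  let ?m = "measure (pos_moment \<mu>) UNIV"
  have "AE h in restrict_space lborel {0<..<?m}. h \<in> {0<..<?m}"
    by (rule AE_I2) (simp add: space_restrict_space)
  then have "AE w in distr (restrict_space lborel {0<..<?m}) borel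
      (\<lambda>h. (quantile (pos_moment \<mu>) h, h)). snd w \<in> {0<..<?m}"
    by (subst AE_distr_iff) (auto intro!: measurable_restrict_space1)
  then have "AE w in distr (pos_moment \<mu> \<Otimes>\<^sub>M unif) borel (\<lambda>z. (fst z, smooth_cdf (pos_moment \<mu>) z)).
      snd w \<in> {0<..<?m}"
    by (simp only: pos.distr_smooth_cdf)
  then have "AE z in pos_moment \<mu> \<Otimes>\<^sub>M unif. smooth_cdf (pos_moment \<mu>) z \<in> {0<..<?m}"
    by (subst (asm) AE_distr_iff) auto
  then show ?thesis
    unfolding pair_pos_moment by (subst (asm) AE_density) auto
qed

lemma AE_smooth_cdf_reflect:
  "AE z in \<mu> \<Otimes>\<^sub>M unif. fst z < 0 \<longrightarrow>
    smooth_cdf (pos_moment (reflect \<mu>)) (- fst z, snd z) \<in> {0<..<measure (pos_moment \<mu>) UNIV}"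
proof -
  interpret R: centered_distribution "reflect \<mu>" by (rule centered_reflect)
  have "AE z in distr (\<mu> \<Otimes>\<^sub>M unif) (borel \<Otimes>\<^sub>M borel) (\<lambda>z. (- fst z, snd z)). 0 < fst z \<longrightarrow>
      smooth_cdf (pos_moment (reflect \<mu>)) z \<in> {0<..<measure (pos_moment \<mu>) UNIV}"
    using R.AE_smooth_cdf unfolding pair_reflect mass_reflect .
  then show ?thesis
    by (rule AE_distrD[rotated, THEN AE_mp]) auto
qed

lemma AE_reciprocating:
  "AE z in \<mu> \<Otimes>\<^sub>M unif. reciprocating \<mu> (ereal (fst z)) (snd z) = ereal (recip_real \<mu> z)"
  using AE_smooth_cdf AE_smooth_cdf_reflect
  by eventually_elim (use reciprocating_eq in auto)

lemma AE_recip_real_sign: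
  "AE z in \<mu> \<Otimes>\<^sub>M unif. if fst z = 0 then recip_real \<mu> z = 0 else fst z * recip_real \<mu> z < 0"
  using AE_smooth_cdf AE_smooth_cdf_reflect
proof eventually_elim
  interpret R: centered_distribution "reflect \<mu>" by (rule centered_reflect)
  case (elim z)
  then show ?case
    using quantile_pos[of "smooth_cdf (pos_moment (reflect \<mu>)) (- fst z, snd z)"]
      R.quantile_pos[of "smooth_cdf (pos_moment \<mu>) z"]
    by (auto simp: recip_real_def mass_reflect mult_less_0_iff)
qed

section \<open>Exchanging a point with its reciprocal\<close>

lemma nn_integral_smooth_cdf:
  assumes [measurable]: "\<Phi> \<in> borel_measurable borel"
  shows "(\<integral>\<^sup>+z. ennreal (fst z) * \<Phi> (fst z, smooth_cdf (pos_moment \<mu>) z) \<partial>(\<mu> \<Otimes>\<^sub>M unif)) =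
    (\<integral>\<^sup>+h. \<Phi> (quantile (pos_moment \<mu>) h, h)
      \<partial>restrict_space lborel {0<..<measure (pos_moment \<mu>) UNIV})"
proof -
  have "(\<integral>\<^sup>+z. ennreal (fst z) * \<Phi> (fst z, smooth_cdf (pos_moment \<mu>) z) \<partial>(\<mu> \<Otimes>\<^sub>M unif)) =
      (\<integral>\<^sup>+z. \<Phi> (fst z, smooth_cdf (pos_moment \<mu>) z) \<partial>(pos_moment \<mu> \<Otimes>\<^sub>M unif))"
    unfolding pair_pos_moment by (subst nn_integral_density) auto
  also have "\<dots> = (\<integral>\<^sup>+w. \<Phi> w \<partial>distr (pos_moment \<mu> \<Otimes>\<^sub>M unif) borel
      (\<lambda>z. (fst z, smooth_cdf (pos_moment \<mu>) z)))"
    by (subst nn_integral_distr) auto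
  also have "\<dots> = (\<integral>\<^sup>+h. \<Phi> (quantile (pos_moment \<mu>) h, h)
      \<partial>restrict_space lborel {0<..<measure (pos_moment \<mu>) UNIV})"
    unfolding pos.distr_smooth_cdf
    by (subst nn_integral_distr) (auto intro!: measurable_restrict_space1)
  finally show ?thesis .
qed

text \<open>
  Both sides equal the integral over the levels \<open>h\<close> of \<open>\<Psi>\<close> at the pair of quantiles
  \<open>x\<^sub>+(h)\<close> and \<open>x\<^sub>-(h)\<close>, once started from the positive and once from the negative half-line.
\<close>

lemma nn_integral_recip_real_swap:
  assumes [measurable]: "\<Psi> \<in> borel_measurable borel"
  shows "(\<integral>\<^sup>+z. ennreal (fst z) * \<Psi> (fst z, recip_real \<mu> z) \<partial>(\<mu> \<Otimes>\<^sub>M unif)) =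
    (\<integral>\<^sup>+z. ennreal (- fst z) * \<Psi> (recip_real \<mu> z, fst z) \<partial>(\<mu> \<Otimes>\<^sub>M unif))"
proof -
  interpret R: centered_distribution "reflect \<mu>" by (rule centered_reflect)
  define Q where "Q = quantile (pos_moment \<mu>)"
  define Q' where "Q' = quantile (pos_moment (reflect \<mu>))"
  have [measurable]: "Q \<in> borel_measurable borel" "Q' \<in> borel_measurable borel"
    by (simp_all add: Q_def Q'_def)
  \<comment> \<open>The weight vanishes unless \<open>0 < fst z\<close>, so only the first branch of
    \<open>recip_real\<close> is seen.\<close>
  have "(\<integral>\<^sup>+z. ennreal (fst z) * \<Psi> (fst z, recip_real \<mu> z) \<partial>(\<mu> \<Otimes>\<^sub>M unif)) =
      (\<integral>\<^sup>+z. ennreal (fst z) * \<Psi> (fst z, - Q' (smooth_cdf (pos_moment \<mu>) z)) \<partial>(\<mu> \<Otimes>\<^sub>M unif))"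
    by (intro nn_integral_cong) (auto simp: recip_real_def Q'_def ennreal_neg not_less)
  also have "\<dots> = (\<integral>\<^sup>+h. \<Psi> (Q h, - Q' h) \<partial>restrict_space lborel {0<..<measure (pos_moment \<mu>) UNIV})"
    unfolding Q_def
    by (subst nn_integral_smooth_cdf[of "\<lambda>w. \<Psi> (fst w, - Q' (snd w))", simplified fst_conv snd_conv])
      simp_all
  also have "\<dots> = (\<integral>\<^sup>+z. ennreal (fst z) * \<Psi> (Q (smooth_cdf (pos_moment (reflect \<mu>)) z), - fst z)
      \<partial>(reflect \<mu> \<Otimes>\<^sub>M unif))"
    unfolding Q'_def
    by (subst R.nn_integral_smooth_cdf[of "\<lambda>w. \<Psi> (Q (snd w), - fst w)", simplified fst_conv snd_conv])
      (simp_all add: mass_reflect)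
  also have "\<dots> = (\<integral>\<^sup>+z. ennreal (- fst z) *
      \<Psi> (Q (smooth_cdf (pos_moment (reflect \<mu>)) (- fst z, snd z)), fst z) \<partial>(\<mu> \<Otimes>\<^sub>M unif))"
    unfolding pair_reflect by (subst nn_integral_distr) auto
  also have "\<dots> = (\<integral>\<^sup>+z. ennreal (- fst z) * \<Psi> (recip_real \<mu> z, fst z) \<partial>(\<mu> \<Otimes>\<^sub>M unif))"
    by (intro nn_integral_cong) (auto simp: recip_real_def Q_def ennreal_neg not_less)
  finally show ?thesis .
qed

lemma nn_integral_two_point_disintegration:
  assumes f [measurable]: "f \<in> borel_measurable borel"
  shows "(\<integral>\<^sup>+z. f (fst z, recip_real \<mu> z) \<partial>(\<mu> \<Otimes>\<^sub>M unif)) =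
    (\<integral>\<^sup>+z. (\<integral>\<^sup>+y. f y \<partial>two_point_kernel (fst z, recip_real \<mu> z)) \<partial>(\<mu> \<Otimes>\<^sub>M unif))"
proof -
  define s :: "real \<times> real \<Rightarrow> real" where "s z = \<bar>fst z\<bar> + \<bar>recip_real \<mu> z\<bar>" for z
  \<comment> \<open>Almost everywhere \<open>v\<close> and \<open>w\<close> are the probabilities of
    \<open>(x, r)\<close> and \<open>(r, x)\<close> under the two-point kernel. At
    \<open>x = 0\<close> also \<open>r = 0\<close>, and the quotient 0 / 0 = 0 would lose the mass
    there; hence the value 1.\<close>
  define v where "v z = (if fst z = 0 then 1 else \<bar>recip_real \<mu> z\<bar> / s z)" for z
  define w where "w z = \<bar>fst z\<bar> / s z" for z
  let ?f = "\<lambda>z. f (fst z, recip_real \<mu> z)" and ?g = "\<lambda>z. f (recip_real \<mu> z, fst z)"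
  have [measurable]: "s \<in> borel_measurable (borel \<Otimes>\<^sub>M borel)"
    "v \<in> borel_measurable (borel \<Otimes>\<^sub>M borel)" "w \<in> borel_measurable (borel \<Otimes>\<^sub>M borel)"
    unfolding s_def v_def w_def by measurable
  have swap: "(\<integral>\<^sup>+z. ennreal (w z) * ?f z \<partial>(\<mu> \<Otimes>\<^sub>M unif)) = (\<integral>\<^sup>+z. ennreal (w z) * ?g z \<partial>(\<mu> \<Otimes>\<^sub>M unif))"
  proof -
    \<comment> \<open>The factor \<open>1 / s z\<close> is symmetric in the point and its
      reciprocal. Moving it into \<open>\<Psi>\<close> leaves the weights x^+ and x^-, the two
      halves of |x|.\<close>
    define \<Psi> where "\<Psi> p = ennreal (1 / (\<bar>fst p\<bar> + \<bar>snd p\<bar>)) * f p" for p :: "real \<times> real"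
    have \<Psi> [measurable]: "\<Psi> \<in> borel_measurable borel" unfolding \<Psi>_def by measurable
    have \<Psi>': "(\<lambda>p. \<Psi> (snd p, fst p)) \<in> borel_measurable borel" by measurable
    have decomp: "ennreal (w z) * c = ennreal (fst z) * (ennreal (1 / s z) * c) +
        ennreal (- fst z) * (ennreal (1 / s z) * c)" for z c
    proof -
      have "ennreal (w z) = (ennreal (fst z) + ennreal (- fst z)) * ennreal (1 / s z)"
        by (cases "0 \<le> fst z")
          (simp_all add: w_def s_def ennreal_neg flip: ennreal_mult)
      then show ?thesis by (simp add: algebra_simps)
    qed
    have 1: "ennreal (1 / s z) * ?f z = \<Psi> (fst z, recip_real \<mu> z)"
      "ennreal (1 / s z) * ?g z = \<Psi> (recip_real \<mu> z, fst z)" for z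
      by (simp_all add: \<Psi>_def s_def add.commute)
    have "(\<integral>\<^sup>+z. ennreal (w z) * ?f z \<partial>(\<mu> \<Otimes>\<^sub>M unif)) =
        (\<integral>\<^sup>+z. ennreal (fst z) * \<Psi> (fst z, recip_real \<mu> z) \<partial>(\<mu> \<Otimes>\<^sub>M unif)) +
        (\<integral>\<^sup>+z. ennreal (- fst z) * \<Psi> (fst z, recip_real \<mu> z) \<partial>(\<mu> \<Otimes>\<^sub>M unif))"
      unfolding decomp 1 by (rule nn_integral_add) measurable
    \<comment> \<open>The exchange is applied to \<open>\<Psi>\<close> and to its transpose, so the
      x^+ term and the x^- term trade places.\<close>
    also have "\<dots> = (\<integral>\<^sup>+z. ennreal (- fst z) * \<Psi> (recip_real \<mu> z, fst z) \<partial>(\<mu> \<Otimes>\<^sub>M unif)) +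
        (\<integral>\<^sup>+z. ennreal (fst z) * \<Psi> (recip_real \<mu> z, fst z) \<partial>(\<mu> \<Otimes>\<^sub>M unif))"
      using nn_integral_recip_real_swap[OF \<Psi>] nn_integral_recip_real_swap[OF \<Psi>'] by simp
    also have "\<dots> = (\<integral>\<^sup>+z. ennreal (w z) * ?g z \<partial>(\<mu> \<Otimes>\<^sub>M unif))"
      unfolding decomp 1 by (subst add.commute, rule nn_integral_add[symmetric]) measurable
    finally show ?thesis .
  qed
  have "(\<integral>\<^sup>+z. ?f z \<partial>(\<mu> \<Otimes>\<^sub>M unif)) =
      (\<integral>\<^sup>+z. ennreal (v z) * ?f z + ennreal (w z) * ?f z \<partial>(\<mu> \<Otimes>\<^sub>M unif))"
  proof (rule nn_integral_cong_AE)
    show "AE z in \<mu> \<Otimes>\<^sub>M unif. ?f z = ennreal (v z) * ?f z + ennreal (w z) * ?f z"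
      using AE_recip_real_sign
    proof eventually_elim
      case (elim z)
      have "0 \<le> v z" "0 \<le> w z" by (auto simp: v_def w_def s_def)
      moreover have "v z + w z = 1"
      proof (cases "fst z = 0")
        case False
        then have "s z \<noteq> 0" unfolding s_def by linarith
        have "v z + w z = (\<bar>recip_real \<mu> z\<bar> + \<bar>fst z\<bar>) / s z"
          using False by (simp add: v_def w_def add_divide_distrib)
        also have "\<dots> = 1" using \<open>s z \<noteq> 0\<close> by (simp add: s_def add.commute)
        finally show ?thesis .
      qed (simp add: v_def w_def)
      ultimately have "ennreal (v z) + ennreal (w z) = 1" by (simp flip: ennreal_plus)
      then show ?case by (simp flip: distrib_right)
    qed
  qed
  also have "\<dots> = (\<integral>\<^sup>+z. ennreal (v z) * ?f z + ennreal (w z) * ?g z \<partial>(\<mu> \<Otimes>\<^sub>M unif))"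
    using swap by (simp add: nn_integral_add)
  also have "\<dots> = (\<integral>\<^sup>+z. (\<integral>\<^sup>+y. f y \<partial>two_point_kernel (fst z, recip_real \<mu> z)) \<partial>(\<mu> \<Otimes>\<^sub>M unif))"
  proof (rule nn_integral_cong_AE)
    show "AE z in \<mu> \<Otimes>\<^sub>M unif. ennreal (v z) * ?f z + ennreal (w z) * ?g z =
        (\<integral>\<^sup>+y. f y \<partial>two_point_kernel (fst z, recip_real \<mu> z))"
      using AE_recip_real_sign
      by eventually_elim
        (auto simp: nn_integral_two_point_kernel[OF f] v_def w_def s_def split: if_splits)
  qed
  finally show ?thesis .
qed

end

section \<open>Products and independent families\<close>

text \<open>\<open>product_prob_space\<close> asks for a probability measure at every index. Outside
  \<open>I\<close> a point mass fills the gap, and \<open>PiM_cong\<close> removes it again.\<close>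

lemma product_prob_space_extend:
  assumes "\<And>i. i \<in> I \<Longrightarrow> prob_space (M i)"
  shows "product_prob_space (\<lambda>i. if i \<in> I then M i else return (count_space UNIV) undefined)"
  using assms by (intro product_prob_spaceI) (auto intro: prob_space_return)

lemma PiM_eqI_prob_space:
  assumes I: "finite I" and M: "\<And>i. i \<in> I \<Longrightarrow> prob_space (M i)"
    and sets: "sets P = sets (PiM I M)"
    and boxes: "\<And>A. (\<And>i. i \<in> I \<Longrightarrow> A i \<in> sets (M i)) \<Longrightarrow>
      emeasure P (Pi\<^sub>E I A) = (\<Prod>i\<in>I. emeasure (M i) (A i))"
  shows "P = PiM I M"
proof -
  let ?N = "\<lambda>i. if i \<in> I then M i else return (count_space UNIV) undefined"
  interpret product_prob_space ?N by (rule product_prob_space_extend[OF M])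
  have "PiM I ?N = PiM I M" by (rule PiM_cong) auto
  moreover have "P = PiM I ?N"
    using sets boxes unfolding \<open>PiM I ?N = PiM I M\<close>[symmetric]
    by (intro PiM_eqI[OF I]) auto
  ultimately show ?thesis by simp
qed

lemma emeasure_PiM_prob_space:
  assumes I: "finite I" and M: "\<And>i. i \<in> I \<Longrightarrow> prob_space (M i)"
    and A: "\<And>i. i \<in> I \<Longrightarrow> A i \<in> sets (M i)"
  shows "emeasure (PiM I M) (Pi\<^sub>E I A) = (\<Prod>i\<in>I. emeasure (M i) (A i))"
proof -
  let ?N = "\<lambda>i. if i \<in> I then M i else return (count_space UNIV) undefined"
  interpret product_prob_space ?N by (rule product_prob_space_extend[OF M])
  have "PiM I ?N = PiM I M" by (rule PiM_cong) auto
  moreover have "emeasure (PiM I ?N) (Pi\<^sub>E I A) = (\<Prod>i\<in>I. emeasure (?N i) (A i))"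
    using A by (intro emeasure_PiM[OF I]) auto
  ultimately show ?thesis by simp
qed

lemma nn_integral_PiM_prod:
  assumes I: "finite I" and M: "\<And>i. i \<in> I \<Longrightarrow> prob_space (M i)"
    and f: "\<And>i. i \<in> I \<Longrightarrow> f i \<in> borel_measurable (M i)"
  shows "(\<integral>\<^sup>+x. (\<Prod>i\<in>I. f i (x i)) \<partial>PiM I M) = (\<Prod>i\<in>I. \<integral>\<^sup>+x. f i x \<partial>M i)"
proof -
  let ?N = "\<lambda>i. if i \<in> I then M i else return (count_space UNIV) undefined"
  interpret product_prob_space ?N by (rule product_prob_space_extend[OF M])
  have "PiM I ?N = PiM I M" by (rule PiM_cong) auto
  moreover have "(\<integral>\<^sup>+x. (\<Prod>i\<in>I. f i (x i)) \<partial>PiM I ?N) = (\<Prod>i\<in>I. \<integral>\<^sup>+x. f i x \<partial>?N i)"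
    using f by (intro product_nn_integral_prod[OF I]) auto
  ultimately show ?thesis by simp
qed

lemma distr_PiM_map:
  assumes I: "finite I" and M: "\<And>i. i \<in> I \<Longrightarrow> prob_space (M i)"
    and f [measurable]: "\<And>i. i \<in> I \<Longrightarrow> f i \<in> M i \<rightarrow>\<^sub>M M' i"
  shows "distr (PiM I M) (PiM I M') (\<lambda>x. \<lambda>i\<in>I. f i (x i)) = PiM I (\<lambda>i. distr (M i) (M' i) (f i))"
proof (rule PiM_eqI_prob_space[OF I])
  show "prob_space (distr (M i) (M' i) (f i))" if "i \<in> I" for i
    using that by (intro prob_space.prob_space_distr M f)
  show "sets (distr (PiM I M) (PiM I M') (\<lambda>x. \<lambda>i\<in>I. f i (x i))) =
      sets (PiM I (\<lambda>i. distr (M i) (M' i) (f i)))"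
    by (simp cong: sets_PiM_cong)
  fix A assume A: "\<And>i. i \<in> I \<Longrightarrow> A i \<in> sets (distr (M i) (M' i) (f i))"
  have m: "(\<lambda>x. \<lambda>i\<in>I. f i (x i)) \<in> PiM I M \<rightarrow>\<^sub>M PiM I M'"
    by (rule measurable_restrict) measurable
  have "emeasure (distr (PiM I M) (PiM I M') (\<lambda>x. \<lambda>i\<in>I. f i (x i))) (Pi\<^sub>E I A) =
      emeasure (PiM I M) (Pi\<^sub>E I (\<lambda>i. f i -` A i \<inter> space (M i)))"
    using A I by (subst emeasure_distr[OF m])
      (auto simp: space_PiM PiE_iff intro!: sets_PiM_I_finite arg_cong2[where f = emeasure])
  also have "\<dots> = (\<Prod>i\<in>I. emeasure (M i) (f i -` A i \<inter> space (M i)))"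
    using A f by (intro emeasure_PiM_prob_space[OF I M]) (auto intro: measurable_sets)
  also have "\<dots> = (\<Prod>i\<in>I. emeasure (distr (M i) (M' i) (f i)) (A i))"
    using A f by (intro prod.cong) (auto simp: emeasure_distr)
  finally show "emeasure (distr (PiM I M) (PiM I M') (\<lambda>x. \<lambda>i\<in>I. f i (x i))) (Pi\<^sub>E I A) =
      (\<Prod>i\<in>I. emeasure (distr (M i) (M' i) (f i)) (A i))" .
qed

lemma (in prob_space) distr_indep_vars:
  assumes I: "finite I" and ind: "indep_vars M' X I"
  shows "distr M (PiM I M') (\<lambda>\<omega>. \<lambda>i\<in>I. X i \<omega>) = PiM I (\<lambda>i. distr M (M' i) (X i))"
\<comment> \<open>\<open>indep_vars_iff_distr_eq_PiM'\<close> concerns nonempty index sets. The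
  empty product, which occurs for \<open>n = 0\<close>, is a one-point space and is checked on its
  only box.\<close>
proof (cases "I = {}")
  case True
  have m: "(\<lambda>\<omega>. \<lambda>i\<in>I. X i \<omega>) \<in> M \<rightarrow>\<^sub>M PiM I M'"
    by (rule measurable_restrict) (simp add: True)
  show ?thesis
  proof (rule PiM_eqI_prob_space)
    fix A
    have "Pi\<^sub>E I A \<in> sets (PiM I M')" using True by (intro sets_PiM_I_finite) auto
    moreover have "(\<lambda>\<omega>. \<lambda>i\<in>I. X i \<omega>) -` Pi\<^sub>E I A \<inter> space M = space M" by (auto simp: True)
    ultimately show "emeasure (distr M (PiM I M') (\<lambda>\<omega>. \<lambda>i\<in>I. X i \<omega>)) (Pi\<^sub>E I A) =
        (\<Prod>i\<in>I. emeasure (distr M (M' i) (X i)) (A i))"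
      using emeasure_space_1 by (subst emeasure_distr[OF m]) (simp_all add: True)
    show "sets (distr M (PiM I M') (\<lambda>\<omega>. \<lambda>i\<in>I. X i \<omega>)) = sets (PiM I (\<lambda>i. distr M (M' i) (X i)))"
      by (simp cong: sets_PiM_cong)
  qed (simp_all add: True)
next
  case False
  then show ?thesis
    using ind indep_vars_iff_distr_eq_PiM'[OF False, where X = X and M' = M']
    by (auto simp: indep_vars_def)
qed

text \<open>The boxes generate the product sigma-algebra and are stable under intersection; on a box
  the product measure is a finite product of functions of one coordinate each.\<close>

lemma measurable_PiM_kernel:
  assumes I: "finite I" and K: "K \<in> B \<rightarrow>\<^sub>M prob_algebra B"
  shows "(\<lambda>p. PiM I (\<lambda>i. K (p i))) \<in> PiM I (\<lambda>_. B) \<rightarrow>\<^sub>M prob_algebra (PiM I (\<lambda>_. B))"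
proof (rule measurable_prob_algebra_generated[where \<Omega> = "\<Pi>\<^sub>E i\<in>I. space B" and
      G = "prod_algebra I (\<lambda>_. B)"])
  have Kp: "prob_space (K (p i))" "sets (K (p i)) = sets B"
    if "p \<in> space (PiM I (\<lambda>_. B))" "i \<in> I" for p i
    using that measurable_space[OF K, of "p i"]
    by (auto simp: space_prob_algebra space_PiM PiE_iff)
  show "prob_space (PiM I (\<lambda>i. K (p i)))" if "p \<in> space (PiM I (\<lambda>_. B))" for p
    using Kp[OF that] by (intro prob_space_PiM)
  show "sets (PiM I (\<lambda>i. K (p i))) = sets (PiM I (\<lambda>_. B))" if "p \<in> space (PiM I (\<lambda>_. B))" for p
    using Kp[OF that] by (intro sets_PiM_cong) auto
  fix S assume "S \<in> prod_algebra I (\<lambda>_. B)"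
  then obtain A where S: "S = Pi\<^sub>E I A" and A [measurable]: "\<And>i. i \<in> I \<Longrightarrow> A i \<in> sets B"
    by (auto simp: prod_algebra_eq_finite[OF I])
  have "(\<lambda>p. \<Prod>i\<in>I. emeasure (K (p i)) (A i)) \<in> borel_measurable (PiM I (\<lambda>_. B))"
  proof (rule borel_measurable_prod_ennreal)
    fix i assume i: "i \<in> I"
    show "(\<lambda>p. emeasure (K (p i)) (A i)) \<in> borel_measurable (PiM I (\<lambda>_. B))"
      using measurable_compose[OF measurable_component_singleton[OF i, of "\<lambda>_. B"]
          measurable_emeasure_kernel[OF measurable_prob_algebraD[OF K] A[OF i]]] .
  qed
  also have "?this \<longleftrightarrow> (\<lambda>p. emeasure (PiM I (\<lambda>i. K (p i))) S) \<in> borel_measurable (PiM I (\<lambda>_. B))"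
    unfolding S using A Kp
    by (intro measurable_cong emeasure_PiM_prob_space[OF I, symmetric]) auto
  finally show "(\<lambda>p. emeasure (PiM I (\<lambda>i. K (p i))) S) \<in> borel_measurable (PiM I (\<lambda>_. B))" .
qed (simp_all add: sets_PiM Int_stable_prod_algebra prod_algebra_sets_into_space)

text \<open>On a box the integral of the product kernel factorizes, so invariance of each
  \<open>L i\<close> under \<open>K\<close> gives invariance of the product law. The claim is the
  integral formula for \<open>\<bind>\<close> at this fixed point.\<close>

lemma nn_integral_PiM_invariant_kernel:
  assumes I: "finite I" and K: "K \<in> B \<rightarrow>\<^sub>M prob_algebra B"
    and L: "\<And>i. i \<in> I \<Longrightarrow> prob_space (L i)" "\<And>i. i \<in> I \<Longrightarrow> sets (L i) = sets B"
    and inv: "\<And>i A. i \<in> I \<Longrightarrow> A \<in> sets B \<Longrightarrow> (\<integral>\<^sup>+p. emeasure (K p) A \<partial>L i) = emeasure (L i) A"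
    and f: "f \<in> borel_measurable (PiM I (\<lambda>_. B))"
  shows "(\<integral>\<^sup>+y. f y \<partial>PiM I L) = (\<integral>\<^sup>+p. (\<integral>\<^sup>+y. f y \<partial>PiM I (\<lambda>i. K (p i))) \<partial>PiM I L)"
proof -
  let ?B = "PiM I (\<lambda>_. B)"
  have sets_L: "sets (PiM I L) = sets ?B" using L(2) by (intro sets_PiM_cong) auto
  interpret PL: prob_space "PiM I L" by (rule prob_space_PiM[OF L(1)])
  have KL: "(\<lambda>p. PiM I (\<lambda>i. K (p i))) \<in> PiM I L \<rightarrow>\<^sub>M subprob_algebra ?B"
    using measurable_prob_algebraD[OF measurable_PiM_kernel[OF I K]]
    by (simp only: measurable_cong_sets[OF sets_L refl])
  have "PiM I L \<bind> (\<lambda>p. PiM I (\<lambda>i. K (p i))) = PiM I L"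
  proof (rule PiM_eqI_prob_space[OF I L(1)])
    show "sets (PiM I L \<bind> (\<lambda>p. PiM I (\<lambda>i. K (p i)))) = sets (PiM I L)"
      using sets_bind[OF sets_kernel[OF KL] PL.not_empty] sets_L by simp
    fix A assume A: "\<And>i. i \<in> I \<Longrightarrow> A i \<in> sets (L i)"
    then have AB: "\<And>i. i \<in> I \<Longrightarrow> A i \<in> sets B" using L(2) by simp
    have "emeasure (PiM I L \<bind> (\<lambda>p. PiM I (\<lambda>i. K (p i)))) (Pi\<^sub>E I A) =
        (\<integral>\<^sup>+p. emeasure (PiM I (\<lambda>i. K (p i))) (Pi\<^sub>E I A) \<partial>PiM I L)"
      using AB I by (intro emeasure_bind[OF PL.not_empty KL]) (auto intro!: sets_PiM_I_finite)
    also have "\<dots> = (\<integral>\<^sup>+p. (\<Prod>i\<in>I. emeasure (K (p i)) (A i)) \<partial>PiM I L)"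
    proof (intro nn_integral_cong emeasure_PiM_prob_space[OF I])
      fix p i assume "p \<in> space (PiM I L)" "i \<in> I"
      then have "p i \<in> space B"
        using sets_eq_imp_space_eq[OF L(2)] by (auto simp: space_PiM PiE_iff)
      then have "K (p i) \<in> space (prob_algebra B)" by (rule measurable_space[OF K])
      then show "prob_space (K (p i))" "A i \<in> sets (K (p i))"
        using AB[OF \<open>i \<in> I\<close>] by (auto simp: space_prob_algebra)
    qed
    also have "\<dots> = (\<Prod>i\<in>I. \<integral>\<^sup>+p. emeasure (K p) (A i) \<partial>L i)"
    proof (rule nn_integral_PiM_prod[OF I L(1)])
      fix i assume i: "i \<in> I"
      have "(\<lambda>p. emeasure (K p) (A i)) \<in> borel_measurable B"
        by (rule measurable_emeasure_kernel[OF measurable_prob_algebraD[OF K] AB[OF i]])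
      then show "(\<lambda>p. emeasure (K p) (A i)) \<in> borel_measurable (L i)"
        by (simp only: measurable_cong_sets[OF L(2)[OF i] refl])
    qed
    also have "\<dots> = (\<Prod>i\<in>I. emeasure (L i) (A i))"
      using AB by (intro prod.cong refl inv)
    finally show "emeasure (PiM I L \<bind> (\<lambda>p. PiM I (\<lambda>i. K (p i)))) (Pi\<^sub>E I A) =
        (\<Prod>i\<in>I. emeasure (L i) (A i))" .
  qed
  then show ?thesis using nn_integral_bind[OF f KL] by simp
qed

section \<open>Independence and law of the pairs formed from X and U\<close>

context prob_space
begin

context
  fixes I :: "'i set" and X U :: "'i \<Rightarrow> 'a \<Rightarrow> real"
  assumes I: "finite I" and X: "indep_vars (\<lambda>_. borel) X I" and U: "indep_vars (\<lambda>_. borel) U I"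
    and XU: "indep_var (\<Pi>\<^sub>M i\<in>I. borel) (\<lambda>\<omega>. \<lambda>i\<in>I. X i \<omega>) (\<Pi>\<^sub>M i\<in>I. borel) (\<lambda>\<omega>. \<lambda>i\<in>I. U i \<omega>)"
begin

text \<open>Filling the coordinates outside \<open>J\<close> with \<open>UNIV\<close> turns the
  events into preimages of boxes over all of \<open>I\<close>, where the independence of the two
  vectors applies; then each family splits by its own independence. Subfamilies \<open>J\<close>
  occur because \<open>indep_sets\<close> quantifies over them.\<close>

lemma prob_pairs_boxes:
  assumes J: "J \<subseteq> I" "J \<noteq> {}" and A: "\<And>i. i \<in> J \<Longrightarrow> A i \<in> sets borel" "\<And>i. i \<in> J \<Longrightarrow> B i \<in> sets borel"
  shows "prob (\<Inter>i\<in>J. X i -` A i \<inter> U i -` B i \<inter> space M) =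
    (\<Prod>i\<in>J. prob (X i -` A i \<inter> space M) * prob (U i -` B i \<inter> space M))"
proof -
  have fJ: "finite J" using I J finite_subset by auto
  define box where "box C = Pi\<^sub>E I (\<lambda>i. if i \<in> J then C i else UNIV)" for C :: "'i \<Rightarrow> real set"
  have box: "box C \<in> sets (\<Pi>\<^sub>M i\<in>I. borel)" if "\<And>i. i \<in> J \<Longrightarrow> C i \<in> sets borel" for C
    unfolding box_def using that I by (intro sets_PiM_I_finite) auto
  have vimage: "(\<lambda>\<omega>. \<lambda>i\<in>I. Z i \<omega>) -` box C \<inter> space M = (\<Inter>i\<in>J. Z i -` C i \<inter> space M)"
    for Z :: "'i \<Rightarrow> 'a \<Rightarrow> real" and C
    using J by (auto simp: box_def PiE_iff split: if_splits)
  have "(\<Inter>i\<in>J. X i -` A i \<inter> U i -` B i \<inter> space M) =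
      (\<lambda>\<omega>. (\<lambda>i\<in>I. X i \<omega>, \<lambda>i\<in>I. U i \<omega>)) -` (box A \<times> box B) \<inter> space M"
    using J by (auto simp: box_def PiE_iff split: if_splits)
  also have "prob \<dots> = prob (\<Inter>i\<in>J. X i -` A i \<inter> space M) * prob (\<Inter>i\<in>J. U i -` B i \<inter> space M)"
    using indep_varD[OF XU box[of A] box[of B]] A by (simp add: vimage)
  also have "\<dots> = (\<Prod>i\<in>J. prob (X i -` A i \<inter> space M)) * (\<Prod>i\<in>J. prob (U i -` B i \<inter> space M))"
    using indep_varsD[OF X J(2) fJ J(1), of A] indep_varsD[OF U J(2) fJ J(1), of B] A by simp
  finally show ?thesis by (simp add: prod.distrib)
qed

lemma rv_XU: "i \<in> I \<Longrightarrow> X i \<in> borel_measurable M" "i \<in> I \<Longrightarrow> U i \<in> borel_measurable M"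
  using X U by (auto simp: indep_vars_def)

lemma distr_pair_XU:
  assumes i: "i \<in> I"
  shows "distr M (borel \<Otimes>\<^sub>M borel) (\<lambda>\<omega>. (X i \<omega>, U i \<omega>)) = distr M borel (X i) \<Otimes>\<^sub>M distr M borel (U i)"
proof (rule pair_measure_eqI[symmetric])
  note rv_XU[OF i, measurable]
  show "sigma_finite_measure (distr M borel (X i))" "sigma_finite_measure (distr M borel (U i))"
    by (auto intro!: prob_space_imp_sigma_finite prob_space_distr)
  show "sets (distr M borel (X i) \<Otimes>\<^sub>M distr M borel (U i)) =
      sets (distr M (borel \<Otimes>\<^sub>M borel) (\<lambda>\<omega>. (X i \<omega>, U i \<omega>)))"
    by simp
  fix A B assume "A \<in> sets (distr M borel (X i))" "B \<in> sets (distr M borel (U i))"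
  then have [measurable]: "A \<in> sets borel" "B \<in> sets borel" by auto
  have "(\<lambda>\<omega>. (X i \<omega>, U i \<omega>)) -` (A \<times> B) \<inter> space M = X i -` A \<inter> U i -` B \<inter> space M" by auto
  then show "emeasure (distr M borel (X i)) A * emeasure (distr M borel (U i)) B =
      emeasure (distr M (borel \<Otimes>\<^sub>M borel) (\<lambda>\<omega>. (X i \<omega>, U i \<omega>))) (A \<times> B)"
    using prob_pairs_boxes[of "{i}" "\<lambda>_. A" "\<lambda>_. B"] i
    by (simp add: emeasure_distr emeasure_eq_measure flip: ennreal_mult)
qed

text \<open>Independence on the intersection-stable rectangles \<open>F i\<close> passes to the
  sigma-algebras they generate. These contain the sigma-algebra of the pair, since both coordinates
  are measurable for them.\<close>

lemma indep_vars_pairs: "indep_vars (\<lambda>_. borel \<Otimes>\<^sub>M borel) (\<lambda>i \<omega>. (X i \<omega>, U i \<omega>)) I"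
  unfolding indep_vars_def2
proof (intro conjI ballI)
  note rv_XU[measurable]
  show "(\<lambda>\<omega>. (X i \<omega>, U i \<omega>)) \<in> M \<rightarrow>\<^sub>M borel \<Otimes>\<^sub>M borel" if "i \<in> I" for i
    using that by measurable
  define F where "F i = {X i -` A \<inter> U i -` B \<inter> space M | A B. A \<in> sets borel \<and> B \<in> sets borel}" for i
  have ev: "X i -` A \<inter> U i -` B \<inter> space M \<in> events"
    if "i \<in> I" "A \<in> sets borel" "B \<in> sets borel" for i A B
  proof -
    have "X i -` A \<inter> U i -` B \<inter> space M = (X i -` A \<inter> space M) \<inter> (U i -` B \<inter> space M)" by auto
    then show ?thesis using that rv_XU by (auto intro!: sets.Int measurable_sets)
  qed
  have "indep_sets F I"
  proof (rule indep_setsI)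
    fix J S assume J: "J \<noteq> {}" "J \<subseteq> I" "finite J" and "\<forall>j\<in>J. S j \<in> F j"
    then have "\<forall>j\<in>J. \<exists>C. S j = X j -` fst C \<inter> U j -` snd C \<inter> space M \<and>
        fst C \<in> sets borel \<and> snd C \<in> sets borel"
      unfolding F_def by fastforce
    then obtain C where C: "\<And>j. j \<in> J \<Longrightarrow> S j = X j -` fst (C j) \<inter> U j -` snd (C j) \<inter> space M"
      "\<And>j. j \<in> J \<Longrightarrow> fst (C j) \<in> sets borel" "\<And>j. j \<in> J \<Longrightarrow> snd (C j) \<in> sets borel"
      by metis
    have "prob (S j) = prob (X j -` fst (C j) \<inter> space M) * prob (U j -` snd (C j) \<inter> space M)"
      if "j \<in> J" for j
      using prob_pairs_boxes[of "{j}" "\<lambda>i. fst (C i)" "\<lambda>i. snd (C i)"] that C J by auto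
    then show "prob (\<Inter>j\<in>J. S j) = (\<Prod>j\<in>J. prob (S j))"
      using prob_pairs_boxes[of J "\<lambda>i. fst (C i)" "\<lambda>i. snd (C i)"] C J by simp
  qed (use ev in \<open>auto simp: F_def\<close>)
  then have "indep_sets (\<lambda>i. sigma_sets (space M) (F i)) I"
  proof (rule indep_sets_sigma)
    show "Int_stable (F i)" for i
    proof (rule Int_stableI)
      fix S T assume "S \<in> F i" "T \<in> F i"
      then obtain A B A' B' where "S = X i -` A \<inter> U i -` B \<inter> space M"
        "T = X i -` A' \<inter> U i -` B' \<inter> space M" "A \<in> sets borel" "B \<in> sets borel"
        "A' \<in> sets borel" "B' \<in> sets borel"
        by (auto simp: F_def)
      then show "S \<inter> T \<in> F i"
        unfolding F_def by (intro CollectI exI[of _ "A \<inter> A'"] exI[of _ "B \<inter> B'"]) auto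
    qed
  qed
  then show "indep_sets (\<lambda>i. {(\<lambda>\<omega>. (X i \<omega>, U i \<omega>)) -` C \<inter> space M | C. C \<in> sets (borel \<Otimes>\<^sub>M borel)}) I"
  proof (rule indep_sets_mono_sets)
    fix i
    have FS: "F i \<subseteq> Pow (space M)" by (auto simp: F_def)
    have "X i \<in> borel_measurable (sigma (space M) (F i))"
    proof (rule measurableI)
      fix A :: "real set" assume "A \<in> sets borel"
      then have "X i -` A \<inter> space M \<in> F i"
        unfolding F_def by (intro CollectI exI[of _ A] exI[of _ UNIV]) auto
      then show "X i -` A \<inter> space (sigma (space M) (F i)) \<in> sets (sigma (space M) (F i))"
        using FS by (simp add: sigma_sets.Basic)
    qed simp
    moreover have "U i \<in> borel_measurable (sigma (space M) (F i))"
    proof (rule measurableI)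
      fix A :: "real set" assume "A \<in> sets borel"
      then have "U i -` A \<inter> space M \<in> F i"
        unfolding F_def by (intro CollectI exI[of _ UNIV] exI[of _ A]) auto
      then show "U i -` A \<inter> space (sigma (space M) (F i)) \<in> sets (sigma (space M) (F i))"
        using FS by (simp add: sigma_sets.Basic)
    qed simp
    ultimately have m: "(\<lambda>\<omega>. (X i \<omega>, U i \<omega>)) \<in> sigma (space M) (F i) \<rightarrow>\<^sub>M borel \<Otimes>\<^sub>M borel"
      by (rule measurable_Pair)
    show "{(\<lambda>\<omega>. (X i \<omega>, U i \<omega>)) -` C \<inter> space M | C. C \<in> sets (borel \<Otimes>\<^sub>M borel)} \<subseteq>
        sigma_sets (space M) (F i)"
      using measurable_sets[OF m] FS by auto
  qed
qed

lemma distr_pairs: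
  "distr M (\<Pi>\<^sub>M i\<in>I. borel \<Otimes>\<^sub>M borel) (\<lambda>\<omega>. \<lambda>i\<in>I. (X i \<omega>, U i \<omega>)) =
   (\<Pi>\<^sub>M i\<in>I. distr M borel (X i) \<Otimes>\<^sub>M distr M borel (U i))"
  unfolding distr_indep_vars[OF I indep_vars_pairs] by (intro PiM_cong refl distr_pair_XU)

end

end

section \<open>Extended integrals and two-point variables\<close>

lemma quasi_integrable_minus_iff: "quasi_integrable M (\<lambda>x. - f x) \<longleftrightarrow> quasi_integrable M f"
  by (auto simp: quasi_integrable_def)

text \<open>Quasi-integrability excludes \<open>\<infinity> - \<infinity>\<close>, which
  \<open>ereal\<close> evaluates to \<open>\<infinity>\<close> on both sides, so that the sign rule
  would fail.\<close>

lemma ext_integral_minus: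
  assumes "quasi_integrable M f"
  shows "ext_integral M (\<lambda>x. - f x) = - ext_integral M f"
proof -
  have "enn2ereal t \<noteq> \<infinity>" if "t < \<infinity>" for t
    using that by (cases t) (auto simp: enn2ereal_ennreal)
  then have "enn2ereal (\<integral>\<^sup>+x. ennreal (f x) \<partial>M) \<noteq> \<infinity> \<or> enn2ereal (\<integral>\<^sup>+x. ennreal (- f x) \<partial>M) \<noteq> \<infinity>"
    using assms unfolding quasi_integrable_def by blast
  moreover have "0 \<le> enn2ereal (\<integral>\<^sup>+x. ennreal (f x) \<partial>M)" "0 \<le> enn2ereal (\<integral>\<^sup>+x. ennreal (- f x) \<partial>M)"
    by simp_all
  ultimately show ?thesis
    unfolding ext_integral_def
    by (cases "enn2ereal (\<integral>\<^sup>+x. ennreal (f x) \<partial>M)"; cases "enn2ereal (\<integral>\<^sup>+x. ennreal (- f x) \<partial>M)")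
      auto
qed

text \<open>The integrands of the theorem are arbitrary on a null set. Their preimages differ from
  those of a Borel version only inside a null set, which the completion absorbs.\<close>

lemma borel_measurable_completion_AE:
  fixes f h :: "'a \<Rightarrow> real"
  assumes h: "h \<in> borel_measurable M" and eq: "AE x in M. f x = h x"
  shows "f \<in> borel_measurable (completion M)"
proof (rule measurableI)
  fix A :: "real set" assume A: "A \<in> sets borel"
  have h': "h \<in> borel_measurable (completion M)" using h by (rule measurable_completion)
  have "f -` A \<inter> space (completion M) =
      ((h -` A \<inter> space (completion M)) - {x \<in> space (completion M). f x \<noteq> h x}) \<union>
      {x \<in> space (completion M). f x \<noteq> h x \<and> f x \<in> A}"
    by auto
  also have "\<dots> \<in> sets (completion M)"
  proof (intro sets.Un sets.Diff measurable_sets[OF h' A])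
    have "Measurable.pred (completion M) (\<lambda>x. f x \<noteq> h x)"
      using eq by (intro sets_completion_AE) simp
    then show "{x \<in> space (completion M). f x \<noteq> h x} \<in> sets (completion M)"
      by (simp add: pred_def)
    have "Measurable.pred (completion M) (\<lambda>x. f x \<noteq> h x \<and> f x \<in> A)"
      using eq by (intro sets_completion_AE) (auto elim: AE_mp)
    then show "{x \<in> space (completion M). f x \<noteq> h x \<and> f x \<in> A} \<in> sets (completion M)"
      by (simp add: pred_def)
  qed
  finally show "f -` A \<inter> space (completion M) \<in> sets (completion M)" .
qed simp

text \<open>As \<open>f\<close> lies above \<open>l\<close> almost everywhere, its negative part is
  dominated by that of \<open>l\<close> and has a finite integral; any divergence comes from
  \<open>q\<close>. Both integrands of the theorem have this shape.\<close>

lemma ext_integral_integrable_plus_nonneg: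
  assumes l: "integrable M l" and q [measurable]: "q \<in> borel_measurable M"
    and nonneg: "\<And>x. x \<in> space M \<Longrightarrow> 0 \<le> q x"
    and f: "AE x in M. f x = l x + q x"
  shows "quasi_integrable M f"
    and "ext_integral M f = ereal (\<integral>x. l x \<partial>M) + enn2ereal (\<integral>\<^sup>+x. ennreal (q x) \<partial>M)"
proof -
  have [measurable]: "l \<in> borel_measurable M" using l by simp
  define P where "P h = (\<integral>\<^sup>+x. ennreal (h x) \<partial>M)" for h :: "'a \<Rightarrow> real"
  have P_l: "P l \<noteq> \<infinity>" "P (\<lambda>x. - l x) \<noteq> \<infinity>"
    using l by (auto simp: real_integrable_def P_def)
  have P_f: "P f = P (\<lambda>x. l x + q x)" "P (\<lambda>x. - f x) = P (\<lambda>x. - (l x + q x))"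
    unfolding P_def by (rule nn_integral_cong_AE, use f in \<open>auto elim: AE_mp\<close>)+
  have "P (\<lambda>x. - f x) \<le> P (\<lambda>x. - l x)"
    unfolding P_f unfolding P_def using nonneg by (intro nn_integral_mono ennreal_leI) auto
  with P_l have neg: "P (\<lambda>x. - f x) \<noteq> \<infinity>" by (auto simp: top_unique)
  then show "quasi_integrable M f"
    using borel_measurable_completion_AE[OF _ f]
    by (auto simp: quasi_integrable_def P_def less_top)
  \<comment> \<open>This is f^+ + l^- = f^- + l^+ + q, integrated. Subtraction is avoided because
    \<open>P f\<close> and \<open>P q\<close> may be infinite.\<close>
  have "P f + P (\<lambda>x. - l x) = P (\<lambda>x. - f x) + P l + P q"
  proof -
    have "P f + P (\<lambda>x. - l x) = (\<integral>\<^sup>+x. ennreal (l x + q x) + ennreal (- l x) \<partial>M)"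
      unfolding P_f unfolding P_def by (rule nn_integral_add[symmetric]) auto
    also have "\<dots> = (\<integral>\<^sup>+x. ennreal (- (l x + q x)) + ennreal (l x) + ennreal (q x) \<partial>M)"
    proof (rule nn_integral_cong)
      fix x assume "x \<in> space M"
      then have "0 \<le> q x" by (rule nonneg)
      have max0: "ennreal t = ennreal (max 0 t)" for t by (simp add: max_def ennreal_neg)
      show "ennreal (l x + q x) + ennreal (- l x) = ennreal (- (l x + q x)) + ennreal (l x) + ennreal (q x)"
        unfolding max0[of "l x + q x"] max0[of "- l x"] max0[of "- (l x + q x)"] max0[of "l x"]
      proof -
        have "max 0 (l x + q x) + max 0 (- l x) = max 0 (- (l x + q x)) + max 0 (l x) + q x"
          using \<open>0 \<le> q x\<close> by (auto simp: max_def)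
        with \<open>0 \<le> q x\<close> show "ennreal (max 0 (l x + q x)) + ennreal (max 0 (- l x)) =
            ennreal (max 0 (- (l x + q x))) + ennreal (max 0 (l x)) + ennreal (q x)"
          by (simp only: ennreal_plus[symmetric] max.cobounded1 add_nonneg_nonneg)
      qed
    qed
    also have "\<dots> = P (\<lambda>x. - f x) + P l + P q"
      unfolding P_f unfolding P_def by (simp add: nn_integral_add)
    finally show ?thesis .
  qed
  then have "enn2ereal (P f) + enn2ereal (P (\<lambda>x. - l x)) =
      enn2ereal (P (\<lambda>x. - f x)) + enn2ereal (P l) + enn2ereal (P q)"
    by (simp flip: plus_ennreal.rep_eq)
  moreover have "(\<integral>x. l x \<partial>M) = enn2real (P l) - enn2real (P (\<lambda>x. - l x))"
    unfolding P_def by (rule real_lebesgue_integral_def[OF l])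
  moreover have "\<exists>r. P h = ennreal r \<and> 0 \<le> r" if "P h \<noteq> \<infinity>" for h
    using that by (cases "P h") auto
  then obtain a b c where "P l = ennreal a" "0 \<le> a" "P (\<lambda>x. - l x) = ennreal b" "0 \<le> b"
    "P (\<lambda>x. - f x) = ennreal c" "0 \<le> c"
    using P_l neg by metis
  ultimately have "enn2ereal (P f) - enn2ereal (P (\<lambda>x. - f x)) = ereal (\<integral>x. l x \<partial>M) + enn2ereal (P q)"
    by (cases "enn2ereal (P f)"; cases "enn2ereal (P q)") (auto simp: enn2ereal_ennreal)
  then show "ext_integral M f = ereal (\<integral>x. l x \<partial>M) + enn2ereal (\<integral>\<^sup>+x. ennreal (q x) \<partial>M)"
    by (simp add: ext_integral_def P_def)
qed

section \<open>Laws and integrals of two-point vectors\<close>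

lemma measurable_two_point_R [measurable]: "two_point_R a b \<in> borel_measurable borel"
  unfolding two_point_R_def by measurable

text \<open>With p the probability of \<open>a\<close>, the mean condition a p + b (1 - p) = 0
  forces p = b / (b - a), which is |b| / (|a| + |b|) for opposite signs. If
  \<open>a * b = 0\<close>, the values have constant sign, and zero mean forces \<open>Y\<close> to
  vanish almost surely.\<close>

lemma (in prob_space) distr_two_point:
  assumes Y: "integrable M Y" "expectation Y = 0" "AE \<omega> in M. Y \<omega> \<in> {a, b}" and ab: "a * b \<le> 0"
  shows "distr M borel (\<lambda>\<omega>. (Y \<omega>, two_point_R a b (Y \<omega>))) = two_point_kernel (a, b)"
proof (rule measure_eqI)
  have [measurable]: "Y \<in> borel_measurable M" using Y(1) by simp
  fix A assume "A \<in> sets (distr M borel (\<lambda>\<omega>. (Y \<omega>, two_point_R a b (Y \<omega>))))"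
  then have A [measurable]: "A \<in> sets borel" by simp
  have "emeasure (distr M borel (\<lambda>\<omega>. (Y \<omega>, two_point_R a b (Y \<omega>)))) A =
      (\<integral>\<^sup>+y. indicator A y \<partial>distr M borel (\<lambda>\<omega>. (Y \<omega>, two_point_R a b (Y \<omega>))))"
    by simp
  also have "\<dots> = (\<integral>\<^sup>+\<omega>. indicator A (Y \<omega>, two_point_R a b (Y \<omega>)) \<partial>M)"
    by (subst nn_integral_distr) auto
  also have "\<dots> = emeasure (two_point_kernel (a, b)) A"
  proof (cases "a * b < 0")
    case True
    then have "a \<noteq> 0" "b \<noteq> 0" "a \<noteq> b" by (auto simp: mult_less_0_iff)
    define p where "p = prob (Y -` {a} \<inter> space M)"
    have prob_b: "prob (Y -` {b} \<inter> space M) = 1 - p"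
    proof -
      have "prob (Y -` {b} \<inter> space M) = prob (space M - (Y -` {a} \<inter> space M))"
        using Y(3) \<open>a \<noteq> b\<close> by (intro finite_measure_eq_AE) auto
      also have "\<dots> = 1 - p" unfolding p_def by (rule prob_compl) auto
      finally show ?thesis .
    qed
    have "expectation Y = (\<integral>\<omega>. a * indicator (Y -` {a} \<inter> space M) \<omega> +
        b * indicator (Y -` {b} \<inter> space M) \<omega> \<partial>M)"
      by (rule integral_cong_AE) (use Y(3) \<open>a \<noteq> b\<close> in \<open>auto simp: indicator_def elim!: AE_mp\<close>)
    also have "\<dots> = a * p + b * (1 - p)"
      by (subst Bochner_Integration.integral_add) (auto simp: p_def[symmetric] prob_b less_top[symmetric])
    finally have "p * (b - a) = b" using Y(2) by (simp add: algebra_simps)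
    then have p: "p = b / (b - a)" using \<open>a \<noteq> b\<close> by (simp add: field_simps)
    have w: "p = \<bar>b\<bar> / (\<bar>a\<bar> + \<bar>b\<bar>)" "1 - p = \<bar>a\<bar> / (\<bar>a\<bar> + \<bar>b\<bar>)"
      using True \<open>a \<noteq> b\<close> unfolding p by (auto simp: mult_less_0_iff field_simps)
    have "(\<integral>\<^sup>+\<omega>. indicator A (Y \<omega>, two_point_R a b (Y \<omega>)) \<partial>M) =
        (\<integral>\<^sup>+\<omega>. indicator A (a, b) * indicator (Y -` {a} \<inter> space M) \<omega> +
          indicator A (b, a) * indicator (Y -` {b} \<inter> space M) \<omega> \<partial>M)"
    proof (rule nn_integral_cong_AE)
      show "AE \<omega> in M. indicator A (Y \<omega>, two_point_R a b (Y \<omega>)) =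
          indicator A (a, b) * indicator (Y -` {a} \<inter> space M) \<omega> +
          indicator A (b, a) * (indicator (Y -` {b} \<inter> space M) \<omega> :: ennreal)"
        using Y(3) AE_space
        by eventually_elim
          (use True \<open>a \<noteq> b\<close> \<open>a \<noteq> 0\<close> \<open>b \<noteq> 0\<close> in \<open>auto simp: two_point_R_def\<close>)
    qed
    also have "\<dots> = indicator A (a, b) * ennreal p + indicator A (b, a) * ennreal (1 - p)"
      by (subst nn_integral_add)
        (auto simp: nn_integral_cmult_indicator emeasure_eq_measure p_def[symmetric] prob_b)
    finally show ?thesis
      using True by (simp add: emeasure_two_point_kernel[OF A] mult.commute flip: w)
  next
    case False
    with ab have ab0: "a * b = 0" by simp
    have "AE \<omega> in M. Y \<omega> = 0"
    proof (cases "0 \<le> a \<and> 0 \<le> b")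
      case True
      then have "AE \<omega> in M. 0 \<le> Y \<omega>" using Y(3) by (auto elim!: AE_mp)
      then show ?thesis using integral_nonneg_eq_0_iff_AE[OF Y(1)] Y(2) by simp
    next
      case False
      then have "a \<le> 0 \<and> b \<le> 0" using ab0 by auto
      then have "AE \<omega> in M. 0 \<le> - Y \<omega>" using Y(3) by (auto elim!: AE_mp)
      then show ?thesis using integral_nonneg_eq_0_iff_AE[of M "\<lambda>\<omega>. - Y \<omega>"] Y(1,2) by simp
    qed
    then have "(\<integral>\<^sup>+\<omega>. indicator A (Y \<omega>, two_point_R a b (Y \<omega>)) \<partial>M) = (\<integral>\<^sup>+\<omega>. indicator A (0, 0) \<partial>M)"
      by (intro nn_integral_cong_AE) (auto simp: two_point_R_def ab0 elim!: AE_mp)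
    also have "\<dots> = indicator A (0, 0)" by (simp add: emeasure_space_1)
    finally show ?thesis using False by (simp add: emeasure_two_point_kernel[OF A])
  qed
  finally show "emeasure (distr M borel (\<lambda>\<omega>. (Y \<omega>, two_point_R a b (Y \<omega>)))) A =
      emeasure (two_point_kernel (a, b)) A" .
qed simp

lemma distr_two_point_vars:
  assumes tp: "two_point_vars n N a b Y" and ab: "\<And>j. j \<in> {1..n} \<Longrightarrow> a j * b j \<le> 0"
  shows "distr N (\<Pi>\<^sub>M j\<in>{1..n}. borel) (\<lambda>\<omega>. \<lambda>j\<in>{1..n}. (Y j \<omega>, two_point_R (a j) (b j) (Y j \<omega>))) =
    (\<Pi>\<^sub>M j\<in>{1..n}. two_point_kernel (a j, b j))"
proof -
  interpret N: prob_space N using tp by (simp add: two_point_vars_def)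
  have "N.indep_vars (\<lambda>_. borel) Y {1..n}" using tp by (simp add: two_point_vars_def)
  then have "N.indep_vars (\<lambda>_. borel) (\<lambda>j \<omega>. (Y j \<omega>, two_point_R (a j) (b j) (Y j \<omega>))) {1..n}"
    by (rule N.indep_vars_compose2[where Y = "\<lambda>j y. (y, two_point_R (a j) (b j) y)"]) auto
  then show ?thesis
    using tp ab
    by (subst N.distr_indep_vars)
      (auto intro!: PiM_cong N.distr_two_point simp: two_point_vars_def)
qed

lemma (in prob_space) centered_linear_form:
  fixes c :: "'i \<Rightarrow> real"
  assumes Z: "\<And>j. j \<in> J \<Longrightarrow> integrable M (Z j)" "\<And>j. j \<in> J \<Longrightarrow> expectation (Z j) = 0"
  shows "integrable M (\<lambda>\<omega>. K + (\<Sum>j\<in>J. c j * Z j \<omega>))"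
    and "expectation (\<lambda>\<omega>. K + (\<Sum>j\<in>J. c j * Z j \<omega>)) = K"
proof -
  have int: "integrable M (\<lambda>\<omega>. \<Sum>j\<in>J. c j * Z j \<omega>)"
    using Z(1) by (intro Bochner_Integration.integrable_sum integrable_mult_right)
  then show "integrable M (\<lambda>\<omega>. K + (\<Sum>j\<in>J. c j * Z j \<omega>))" by simp
  have "expectation (\<lambda>\<omega>. \<Sum>j\<in>J. c j * Z j \<omega>) = (\<Sum>j\<in>J. c j * expectation (Z j))"
    using Z(1) by (subst Bochner_Integration.integral_sum) auto
  then show "expectation (\<lambda>\<omega>. K + (\<Sum>j\<in>J. c j * Z j \<omega>)) = K"
    using int Z(2) by (simp add: prob_space)
qed

lemma measurable_linear_form_fst [measurable]:
  fixes c :: "nat \<Rightarrow> real"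
  shows "(\<lambda>y. K + (\<Sum>j=1..n. c j * fst (y j)))
    \<in> borel_measurable (\<Pi>\<^sub>M j\<in>{1..n}. (borel :: (real \<times> real) measure))"
proof (intro borel_measurable_add borel_measurable_const borel_measurable_sum borel_measurable_times)
  fix j assume "j \<in> {1..n}"
  then show "(\<lambda>y. fst (y j)) \<in> borel_measurable (\<Pi>\<^sub>M j\<in>{1..n}. (borel :: (real \<times> real) measure))"
    by (intro measurable_compose[OF measurable_component_singleton[where M = "\<lambda>_. borel"]]) measurable
qed

text \<open>Almost surely the two-point vector takes only finitely many values, so \<open>g\<close>
  is integrable along it without a growth condition. The linear form contributes only
  \<open>K\<close> because the \<open>Y j\<close> are centred, and the nonnegative rest
  \<open>S\<close> is the quantity to which kernel invariance applies.\<close>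

lemma integral_two_point_vars:
  assumes tp: "two_point_vars n N a b Y" and ab: "\<And>j. j \<in> {1..n} \<Longrightarrow> a j * b j \<le> 0"
    and g [measurable]: "g \<in> borel_measurable (\<Pi>\<^sub>M j\<in>{1..n}. borel)"
    and lower: "\<And>y. y \<in> {1..n} \<rightarrow>\<^sub>E UNIV \<Longrightarrow> K + (\<Sum>j=1..n. c j * fst (y j)) \<le> g y"
  defines "S \<equiv> \<integral>\<^sup>+y. ennreal (g y - (K + (\<Sum>j=1..n. c j * fst (y j))))
    \<partial>(\<Pi>\<^sub>M j\<in>{1..n}. two_point_kernel (a j, b j))"
  shows "S < \<infinity>"
    and "(\<integral>\<omega>. g (\<lambda>j\<in>{1..n}. (Y j \<omega>, two_point_R (a j) (b j) (Y j \<omega>))) \<partial>N) = K + enn2real S"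
proof -
  interpret N: prob_space N using tp by (simp add: two_point_vars_def)
  let ?R = "\<lambda>j. two_point_R (a j) (b j)"
  define V where "V \<omega> = (\<lambda>j\<in>{1..n}. (Y j \<omega>, ?R j (Y j \<omega>)))" for \<omega>
  have Y: "integrable N (Y j)" "(\<integral>\<omega>. Y j \<omega> \<partial>N) = 0" "AE \<omega> in N. Y j \<omega> \<in> {a j, b j}"
    if "j \<in> {1..n}" for j
    using that tp by (auto simp: two_point_vars_def)
  have V [measurable]: "V \<in> N \<rightarrow>\<^sub>M (\<Pi>\<^sub>M j\<in>{1..n}. borel)"
    unfolding V_def
  proof (rule measurable_restrict)
    fix j assume "j \<in> {1..n}"
    then have [measurable]: "Y j \<in> borel_measurable N" using Y(1) by auto
    show "(\<lambda>\<omega>. (Y j \<omega>, ?R j (Y j \<omega>))) \<in> borel_measurable N" by measurable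
  qed
  let ?l = "\<lambda>y. K + (\<Sum>j=1..n. c j * fst (y j))"
  have l_V: "?l (V \<omega>) = K + (\<Sum>j\<in>{1..n}. c j * Y j \<omega>)" for \<omega>
    by (simp add: V_def)
  have int_l: "integrable N (\<lambda>\<omega>. ?l (V \<omega>))" and l0: "(\<integral>\<omega>. ?l (V \<omega>) \<partial>N) = K"
    unfolding l_V by (rule N.centered_linear_form[OF Y(1,2)]; simp)+
  have int_g: "integrable N (\<lambda>\<omega>. g (V \<omega>))"
  proof (rule N.integrable_const_bound)
    let ?F = "Pi\<^sub>E {1..n} (\<lambda>j. {(a j, ?R j (a j)), (b j, ?R j (b j))})"
    have "AE \<omega> in N. \<forall>j\<in>{1..n}. Y j \<omega> \<in> {a j, b j}"
      using Y(3) by (intro AE_finite_allI) auto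
    then have "AE \<omega> in N. V \<omega> \<in> ?F"
      by eventually_elim (auto simp: V_def PiE_iff)
    then show "AE \<omega> in N. norm (g (V \<omega>)) \<le> Max ((\<lambda>y. norm (g y)) ` ?F)"
      by eventually_elim (intro Max_ge finite_imageI finite_PiE imageI, auto)
  qed measurable
  have V_space: "V \<omega> \<in> {1..n} \<rightarrow>\<^sub>E UNIV" for \<omega> by (simp add: V_def)
  have S: "S = (\<integral>\<^sup>+\<omega>. ennreal (g (V \<omega>) - ?l (V \<omega>)) \<partial>N)"
  proof -
    have "distr N (\<Pi>\<^sub>M j\<in>{1..n}. borel) V = (\<Pi>\<^sub>M j\<in>{1..n}. two_point_kernel (a j, b j))"
      using distr_two_point_vars[OF tp ab] unfolding V_def by simp
    then have "S = (\<integral>\<^sup>+y. ennreal (g y - ?l y) \<partial>distr N (\<Pi>\<^sub>M j\<in>{1..n}. borel) V)"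
      by (simp add: S_def)
    also have "\<dots> = (\<integral>\<^sup>+\<omega>. ennreal (g (V \<omega>) - ?l (V \<omega>)) \<partial>N)"
      by (rule nn_integral_distr[OF V]) measurable
    finally show ?thesis .
  qed
  have int: "integrable N (\<lambda>\<omega>. g (V \<omega>) - ?l (V \<omega>))"
    by (rule Bochner_Integration.integrable_diff[OF int_g int_l])
  have nonneg: "0 \<le> g (V \<omega>) - ?l (V \<omega>)" for \<omega>
    using lower[OF V_space[of \<omega>]] by linarith
  have "S = ennreal (\<integral>\<omega>. g (V \<omega>) - ?l (V \<omega>) \<partial>N)"
    unfolding S by (rule nn_integral_eq_integral[OF int]) (use nonneg in auto)
  moreover have "(\<integral>\<omega>. g (V \<omega>) - ?l (V \<omega>) \<partial>N) = (\<integral>\<omega>. g (V \<omega>) \<partial>N) - K"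
    using Bochner_Integration.integral_diff[OF int_g int_l] l0 by simp
  moreover have "0 \<le> (\<integral>\<omega>. g (V \<omega>) - ?l (V \<omega>) \<partial>N)"
    using nonneg by (intro integral_nonneg_AE) auto
  ultimately show "S < \<infinity>" "(\<integral>\<omega>. g (\<lambda>j\<in>{1..n}. (Y j \<omega>, ?R j (Y j \<omega>))) \<partial>N) = K + enn2real S"
    by (simp_all add: V_def)
qed

section \<open>The disintegration for a function bounded below by a linear form\<close>

lemma nn_integral_distr_codomain:
  assumes "T \<in> P \<rightarrow>\<^sub>M Q" "f \<in> borel_measurable Q"
  shows "(\<integral>\<^sup>+y. f y \<partial>distr P Q T) = (\<integral>\<^sup>+x. f (T x) \<partial>P)"
  using assms by (simp add: nn_integral_distr)

text \<open>Both sides reduce to \<open>K\<close> plus one nonnegative integral. \<open>q_W\<close>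
  carries it from \<open>M\<close> to the product law of the points and uniform variables, and
  \<open>q_V\<close> is the invariance of the law of the pairs under the product kernel.\<close>

lemma expectation_disintegration_bounded_below:
  fixes n :: nat
    and M :: "'a measure" and X U :: "nat \<Rightarrow> 'a \<Rightarrow> real"
    and N :: "(nat \<Rightarrow> real) \<Rightarrow> (nat \<Rightarrow> real) \<Rightarrow> 'b measure"
    and Y :: "(nat \<Rightarrow> real) \<Rightarrow> (nat \<Rightarrow> real) \<Rightarrow> nat \<Rightarrow> 'b \<Rightarrow> real"
    and g :: "(nat \<Rightarrow> real \<times> real) \<Rightarrow> real"
    and L :: "'a \<Rightarrow> real" and H :: "(nat \<Rightarrow> real \<times> real) \<Rightarrow> real"
  assumes M: "prob_space M"
    and indep_X: "prob_space.indep_vars M (\<lambda>_. borel) X {1..n}"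
    and integrable_X: "\<And>j. j \<in> {1..n} \<Longrightarrow> integrable M (X j)"
    and zero_mean_X: "\<And>j. j \<in> {1..n} \<Longrightarrow> (\<integral>\<omega>. X j \<omega> \<partial>M) = 0"
    and indep_U: "prob_space.indep_vars M (\<lambda>_. borel) U {1..n}"
    and uniform_U: "\<And>j. j \<in> {1..n} \<Longrightarrow> distr M borel (U j) = uniform_measure lborel {0..1}"
    and indep_X_U: "prob_space.indep_var M
          (\<Pi>\<^sub>M j\<in>{1..n}. borel) (\<lambda>\<omega>. \<lambda>j\<in>{1..n}. X j \<omega>)
          (\<Pi>\<^sub>M j\<in>{1..n}. borel) (\<lambda>\<omega>. \<lambda>j\<in>{1..n}. U j \<omega>)"
    and two_point: "\<And>a b. (\<And>j. j \<in> {1..n} \<Longrightarrow> a j * b j \<le> 0) \<Longrightarrow>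
          two_point_vars n (N a b) a b (Y a b)"
    and g [measurable]: "g \<in> borel_measurable (\<Pi>\<^sub>M j\<in>{1..n}. borel)"
    and lower: "\<And>y. y \<in> {1..n} \<rightarrow>\<^sub>E UNIV \<Longrightarrow> K + (\<Sum>j=1..n. c j * fst (y j)) \<le> g y"
    and L: "\<And>\<omega>. \<omega> \<in> space M \<Longrightarrow>
          (\<And>j. j \<in> {1..n} \<Longrightarrow> U j \<omega> \<in> {0..1} \<and> \<bar>recip_rv M (X j) (X j \<omega>) (U j \<omega>)\<bar> \<noteq> \<infinity>) \<Longrightarrow>
          L \<omega> = g (\<lambda>j\<in>{1..n}. (X j \<omega>, real_of_ereal (recip_rv M (X j) (X j \<omega>) (U j \<omega>))))"
    and H: "\<And>z a b. z \<in> {1..n} \<rightarrow>\<^sub>E UNIV \<times> {0..1} \<Longrightarrow>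
          (\<And>j. j \<in> {1..n} \<Longrightarrow> \<bar>recip_rv M (X j) (fst (z j)) (snd (z j))\<bar> \<noteq> \<infinity>) \<Longrightarrow>
          a = (\<lambda>j. fst (z j)) \<Longrightarrow>
          b = (\<lambda>j. real_of_ereal (recip_rv M (X j) (fst (z j)) (snd (z j)))) \<Longrightarrow>
          H z = (\<integral>\<omega>. g (\<lambda>j\<in>{1..n}. (Y a b j \<omega>, two_point_R (a j) (b j) (Y a b j \<omega>))) \<partial>N a b)"
  shows "quasi_integrable M L \<and>
    quasi_integrable (\<Pi>\<^sub>M j\<in>{1..n}. distr M borel (X j) \<Otimes>\<^sub>M uniform_measure lborel {0..1}) H \<and>
    ext_integral M L =
      ext_integral (\<Pi>\<^sub>M j\<in>{1..n}. distr M borel (X j) \<Otimes>\<^sub>M uniform_measure lborel {0..1}) H"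
proof -
  interpret M: prob_space M by fact
  define \<mu> where "\<mu> j = distr M borel (X j)" for j
  define \<nu> where "\<nu> j = \<mu> j \<Otimes>\<^sub>M unif" for j
  let ?I = "{1..n}" and ?\<nu> = "PiM {1..n} \<nu>"
  let ?B = "\<Pi>\<^sub>M j\<in>{1..n}. (borel :: (real \<times> real) measure)"
  have recip_rv: "recip_rv M (X j) x u = reciprocating (\<mu> j) (ereal x) u" for j x u
    by (simp add: recip_rv_def \<mu>_def)
  have X [measurable]: "X j \<in> borel_measurable M" if "j \<in> ?I" for j
    using integrable_X[OF that] by simp
  have U [measurable]: "U j \<in> borel_measurable M" if "j \<in> ?I" for j
    using indep_U that by (auto simp: M.indep_vars_def)
  have \<mu>: "centered_distribution (\<mu> j)" if j: "j \<in> ?I" for j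
  proof -
    have i: "integrable (\<mu> j) (\<lambda>x. x)"
      unfolding \<mu>_def integrable_distr_eq[OF X[OF j] measurable_ident_sets[OF refl]]
      by (rule integrable_X[OF j])
    have z: "(\<integral>x. x \<partial>\<mu> j) = 0"
      unfolding \<mu>_def integral_distr[OF X[OF j] measurable_ident_sets[OF refl]]
      by (rule zero_mean_X[OF j])
    have "prob_space (\<mu> j)" unfolding \<mu>_def by (rule M.prob_space_distr[OF X[OF j]])
    with i z show ?thesis
      by (intro centered_distribution.intro centered_distribution_axioms.intro) (simp_all add: \<mu>_def)
  qed
  have sets_\<nu>: "sets (\<nu> j) = sets (borel \<Otimes>\<^sub>M borel)" for j
    unfolding \<nu>_def \<mu>_def by (intro sets_pair_measure_cong) auto
  have prob_\<nu>: "prob_space (\<nu> j)" if "j \<in> ?I" for j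
  proof -
    interpret A: centered_distribution "\<mu> j" by (rule \<mu>[OF that])
    interpret U: prob_space unif by (rule prob_space_unif)
    interpret P: pair_prob_space "\<mu> j" unif ..
    show ?thesis unfolding \<nu>_def by (rule P.prob_space_axioms)
  qed
  interpret \<nu>: prob_space ?\<nu> by (rule prob_space_PiM[OF prob_\<nu>])
  have distr_XU: "distr M (borel \<Otimes>\<^sub>M borel) (\<lambda>\<omega>. (X j \<omega>, U j \<omega>)) = \<nu> j" if "j \<in> ?I" for j
    using M.distr_pair_XU[OF _ indep_X indep_U indep_X_U that] uniform_U[OF that]
    by (simp add: \<nu>_def \<mu>_def)

  define h where "h j z = (fst z, recip_real (\<mu> j) z)" for j and z :: "real \<times> real"
  have recip_meas [measurable]: "recip_real (\<mu> j) \<in> borel_measurable (borel \<Otimes>\<^sub>M borel)" if "j \<in> ?I" for j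
    by (rule centered_distribution.measurable_recip_real[OF \<mu>[OF that]])
  have h [measurable]: "h j \<in> (borel \<Otimes>\<^sub>M borel) \<rightarrow>\<^sub>M borel" if "j \<in> ?I" for j
    using recip_meas[OF that] unfolding h_def by measurable
  \<comment> \<open>These are the demands of the hypotheses \<open>L\<close>, \<open>H\<close> and
    \<open>two_point\<close>: \<open>u\<close> in range, a finite reciprocal, and a nonpositive
    product. They hold almost everywhere, and for finitely many \<open>j\<close>
    simultaneously.\<close>
  define good where "good j z \<longleftrightarrow> snd z \<in> {0..1} \<and> fst z * recip_real (\<mu> j) z \<le> 0 \<and>
    reciprocating (\<mu> j) (ereal (fst z)) (snd z) = ereal (recip_real (\<mu> j) z)" for j z
  have good: "AE z in \<nu> j. good j z" if "j \<in> ?I" for j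
  proof -
    interpret A: centered_distribution "\<mu> j" by (rule \<mu>[OF that])
    interpret U: prob_space unif by (rule prob_space_unif)
    interpret P: pair_sigma_finite "\<mu> j" unif ..
    have "AE z in \<mu> j \<Otimes>\<^sub>M unif. 0 \<le> snd z \<and> snd z \<le> 1"
    proof (rule P.AE_pair_measure)
      show "AE x in \<mu> j. AE u in unif. 0 \<le> snd (x, u) \<and> snd (x, u) \<le> 1"
        using AE_unif by simp
    qed measurable
    then show ?thesis
      unfolding \<nu>_def using A.AE_reciprocating A.AE_recip_real_sign
      by eventually_elim (auto simp: good_def split: if_splits)
  qed
  have good_M: "AE \<omega> in M. \<forall>j\<in>?I. good j (X j \<omega>, U j \<omega>)"
  proof (rule AE_finite_allI)
    fix j assume j: "j \<in> ?I"
    have m: "(\<lambda>\<omega>. (X j \<omega>, U j \<omega>)) \<in> M \<rightarrow>\<^sub>M borel \<Otimes>\<^sub>M borel"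
      by (rule measurable_Pair[OF X[OF j] U[OF j]])
    have "AE z in distr M (borel \<Otimes>\<^sub>M borel) (\<lambda>\<omega>. (X j \<omega>, U j \<omega>)). good j z"
      unfolding distr_XU[OF j] by (rule good[OF j])
    from AE_distrD[OF m this] show "AE \<omega> in M. good j (X j \<omega>, U j \<omega>)" .
  qed simp
  have good_\<nu>: "AE z in ?\<nu>. \<forall>j\<in>?I. good j (z j)"
    by (intro AE_finite_allI AE_PiM_component prob_\<nu> good) auto

  define V where "V z = (\<lambda>j\<in>?I. h j (z j))" for z
  have V: "V \<in> ?\<nu> \<rightarrow>\<^sub>M ?B"
    unfolding V_def
  proof (rule measurable_restrict)
    fix j assume j: "j \<in> ?I"
    have "h j \<in> \<nu> j \<rightarrow>\<^sub>M borel"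
      using h[OF j] by (simp only: measurable_cong_sets[OF sets_\<nu> refl])
    then show "(\<lambda>z. h j (z j)) \<in> ?\<nu> \<rightarrow>\<^sub>M borel"
      by (rule measurable_compose[OF measurable_component_singleton[OF j]])
  qed
  define W where "W \<omega> = (\<lambda>j\<in>?I. (X j \<omega>, U j \<omega>))" for \<omega>
  have W: "W \<in> M \<rightarrow>\<^sub>M (\<Pi>\<^sub>M j\<in>?I. borel \<Otimes>\<^sub>M borel)"
    unfolding W_def by (rule measurable_restrict) measurable
  have distr_W: "distr M (\<Pi>\<^sub>M j\<in>?I. borel \<Otimes>\<^sub>M borel) W = ?\<nu>"
  proof -
    have "distr M (\<Pi>\<^sub>M j\<in>?I. borel \<Otimes>\<^sub>M borel) W = (\<Pi>\<^sub>M j\<in>?I. distr M borel (X j) \<Otimes>\<^sub>M distr M borel (U j))"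
      unfolding W_def by (rule M.distr_pairs[OF _ indep_X indep_U indep_X_U]) simp
    also have "\<dots> = ?\<nu>"
      by (rule PiM_cong) (simp_all add: \<nu>_def \<mu>_def uniform_U)
    finally show ?thesis .
  qed
  have V': "V \<in> (\<Pi>\<^sub>M j\<in>?I. borel \<Otimes>\<^sub>M borel) \<rightarrow>\<^sub>M ?B"
  proof -
    have "sets ?\<nu> = sets (\<Pi>\<^sub>M j\<in>?I. borel \<Otimes>\<^sub>M borel)"
      by (rule sets_PiM_cong[OF refl sets_\<nu>])
    from measurable_cong_sets[OF this refl] V show ?thesis by blast
  qed
  have VW: "(\<lambda>\<omega>. V (W \<omega>)) \<in> M \<rightarrow>\<^sub>M ?B"
    by (rule measurable_compose[OF W V'])

  \<comment> \<open>\<open>\<Lambda> j\<close> is the law of \<open>X j\<close> together with its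
    reciprocal, which the two-point kernel leaves invariant.\<close>
  define \<Lambda> where "\<Lambda> j = distr (\<nu> j) borel (h j)" for j
  have h_\<nu>: "h j \<in> \<nu> j \<rightarrow>\<^sub>M borel" if "j \<in> ?I" for j
    using h[OF that] by (simp only: measurable_cong_sets[OF sets_\<nu> refl])
  have distr_V: "distr ?\<nu> ?B V = PiM ?I \<Lambda>"
    unfolding V_def \<Lambda>_def by (rule distr_PiM_map[OF _ prob_\<nu> h_\<nu>]) auto

  let ?l = "\<lambda>y. K + (\<Sum>j=1..n. c j * fst (y j))"
  let ?q = "\<lambda>y. g y - ?l y"
  have q_real: "?q \<in> borel_measurable ?B" by measurable
  then have q: "(\<lambda>y. ennreal (?q y)) \<in> borel_measurable ?B" by (rule measurable_compose) simp
  define S where "S p = (\<integral>\<^sup>+y. ennreal (?q y) \<partial>(\<Pi>\<^sub>M j\<in>?I. two_point_kernel (p j)))" for p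
  have S [measurable]: "S \<in> borel_measurable ?B"
    unfolding S_def
    using measurable_prob_algebraD[OF measurable_PiM_kernel[OF _ measurable_two_point_kernel, of ?I]]
    by (rule measurable_compose[OF _ nn_integral_measurable_subprob_algebra[OF q]]) simp
  have q_V: "(\<integral>\<^sup>+z. ennreal (?q (V z)) \<partial>?\<nu>) = (\<integral>\<^sup>+z. S (V z) \<partial>?\<nu>)"
  proof -
    have "(\<integral>\<^sup>+z. ennreal (?q (V z)) \<partial>?\<nu>) = (\<integral>\<^sup>+y. ennreal (?q y) \<partial>PiM ?I \<Lambda>)"
      unfolding distr_V[symmetric] by (rule nn_integral_distr_codomain[OF V q, symmetric])
    also have "\<dots> = (\<integral>\<^sup>+p. S p \<partial>PiM ?I \<Lambda>)"
      unfolding S_def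
    proof (rule nn_integral_PiM_invariant_kernel[OF _ measurable_two_point_kernel])
      fix j assume j: "j \<in> ?I"
      interpret A: centered_distribution "\<mu> j" by (rule \<mu>[OF j])
      show "prob_space (\<Lambda> j)" unfolding \<Lambda>_def by (rule prob_space.prob_space_distr[OF prob_\<nu> h_\<nu>]) fact+
      show "sets (\<Lambda> j) = sets borel" by (simp add: \<Lambda>_def)
      fix A :: "(real \<times> real) set" assume A [measurable]: "A \<in> sets borel"
      have m: "(\<lambda>p. emeasure (two_point_kernel p) A) \<in> borel_measurable borel"
        by (rule measurable_emeasure_kernel[OF measurable_prob_algebraD[OF measurable_two_point_kernel] A])
      have "(\<integral>\<^sup>+p. emeasure (two_point_kernel p) A \<partial>\<Lambda> j) =
          (\<integral>\<^sup>+z. emeasure (two_point_kernel (h j z)) A \<partial>\<nu> j)"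
        unfolding \<Lambda>_def by (rule nn_integral_distr_codomain[OF h_\<nu>[OF j] m])
      also have "\<dots> = (\<integral>\<^sup>+z. (\<integral>\<^sup>+y. indicator A y \<partial>two_point_kernel (fst z, recip_real (\<mu> j) z)) \<partial>\<nu> j)"
        by (simp add: h_def)
      also have "\<dots> = (\<integral>\<^sup>+z. indicator A (h j z) \<partial>\<nu> j)"
        unfolding \<nu>_def h_def by (rule A.nn_integral_two_point_disintegration[symmetric]) measurable
      also have "\<dots> = (\<integral>\<^sup>+y. indicator A y \<partial>\<Lambda> j)"
        unfolding \<Lambda>_def by (rule nn_integral_distr_codomain[OF h_\<nu>[OF j], symmetric]) measurable
      finally show "(\<integral>\<^sup>+p. emeasure (two_point_kernel p) A \<partial>\<Lambda> j) = emeasure (\<Lambda> j) A"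
        by (simp add: \<Lambda>_def)
    qed (simp, rule q)
    also have "\<dots> = (\<integral>\<^sup>+z. S (V z) \<partial>?\<nu>)"
      unfolding distr_V[symmetric] by (rule nn_integral_distr_codomain[OF V S])
    finally show ?thesis .
  qed
  have q_W: "(\<integral>\<^sup>+\<omega>. ennreal (?q (V (W \<omega>))) \<partial>M) = (\<integral>\<^sup>+z. ennreal (?q (V z)) \<partial>?\<nu>)"
  proof -
    have "(\<lambda>z. ennreal (?q (V z))) \<in> borel_measurable (\<Pi>\<^sub>M j\<in>?I. borel \<Otimes>\<^sub>M borel)"
      by (rule measurable_compose[OF V' q])
    then show ?thesis unfolding distr_W[symmetric] by (rule nn_integral_distr_codomain[OF W, symmetric])
  qed
  have q_nonneg: "0 \<le> ?q (V z)" for z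
    using lower[of "V z"] by (simp add: V_def)

  have L_AE: "AE \<omega> in M. L \<omega> = ?l (V (W \<omega>)) + ?q (V (W \<omega>))"
    using good_M AE_space
  proof eventually_elim
    case (elim \<omega>)
    have "L \<omega> = g (\<lambda>j\<in>?I. (X j \<omega>, real_of_ereal (recip_rv M (X j) (X j \<omega>) (U j \<omega>))))"
      by (rule L) (use elim in \<open>auto simp: good_def recip_rv\<close>)
    also have "(\<lambda>j\<in>?I. (X j \<omega>, real_of_ereal (recip_rv M (X j) (X j \<omega>) (U j \<omega>)))) = V (W \<omega>)"
      using elim by (auto simp: V_def W_def h_def good_def recip_rv intro!: restrict_ext)
    finally show ?case by simp
  qed
  have l_W: "?l (V (W \<omega>)) = K + (\<Sum>j\<in>?I. c j * X j \<omega>)" for \<omega>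
    by (simp add: V_def W_def h_def)
  have l_int: "integrable M (\<lambda>\<omega>. ?l (V (W \<omega>)))" "(\<integral>\<omega>. ?l (V (W \<omega>)) \<partial>M) = K"
    unfolding l_W by (rule M.centered_linear_form[OF integrable_X zero_mean_X]; simp)+
  have "(\<lambda>\<omega>. ?q (V (W \<omega>))) \<in> borel_measurable M"
    by (rule measurable_compose[OF VW q_real])
  note L_res = ext_integral_integrable_plus_nonneg[OF l_int(1) this q_nonneg L_AE]

  \<comment> \<open>At a good \<open>z\<close> the inner variables form a genuine two-point family,
    so \<open>S (V z)\<close> is finite and passing through \<open>enn2real\<close> loses
    nothing.\<close>
  have H_AE: "AE z in ?\<nu>. S (V z) < \<infinity> \<and> H z = K + enn2real (S (V z))"
    using good_\<nu> AE_space
  proof eventually_elim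
    case (elim z)
    define a where "a j = fst (z j)" for j
    define b where "b j = real_of_ereal (recip_rv M (X j) (fst (z j)) (snd (z j)))" for j
    have ab: "(a j, b j) = V z j" "a j * b j \<le> 0" if "j \<in> ?I" for j
      using elim(1) that by (auto simp: a_def b_def V_def h_def good_def recip_rv)
    have S_eq: "S (V z) = (\<integral>\<^sup>+y. ennreal (?q y) \<partial>(\<Pi>\<^sub>M j\<in>?I. two_point_kernel (a j, b j)))"
    proof -
      have "(\<Pi>\<^sub>M j\<in>?I. two_point_kernel (V z j)) = (\<Pi>\<^sub>M j\<in>?I. two_point_kernel (a j, b j))"
        by (rule PiM_cong) (simp_all add: ab)
      then show ?thesis by (simp add: S_def)
    qed
    have "z \<in> ?I \<rightarrow>\<^sub>E UNIV \<times> {0..1}"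
      using elim by (auto simp: space_PiM PiE_iff good_def mem_Times_iff)
    then have Hz: "H z = (\<integral>\<omega>. g (\<lambda>j\<in>?I. (Y a b j \<omega>, two_point_R (a j) (b j) (Y a b j \<omega>))) \<partial>N a b)"
      by (rule H) (use elim(1) in \<open>auto simp: a_def b_def good_def recip_rv fun_eq_iff\<close>)
    note S_ab = integral_two_point_vars[OF two_point[OF ab(2)] ab(2) g lower]
    show ?case unfolding S_eq using S_ab(1) trans[OF Hz S_ab(2)] by (rule conjI)
  qed
  have SV: "(\<lambda>z. enn2real (S (V z))) \<in> borel_measurable ?\<nu>"
    by (rule measurable_compose[OF V]) measurable
  have "AE z in ?\<nu>. H z = K + enn2real (S (V z))"
    using H_AE by eventually_elim simp
  \<comment> \<open>The integrable summand is now the constant \<open>K\<close>: inside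
    \<open>H\<close> the linear form has already been averaged out.\<close>
  note H_res = ext_integral_integrable_plus_nonneg[OF \<nu>.integrable_const SV enn2real_nonneg this]
  have "(\<integral>\<^sup>+z. ennreal (enn2real (S (V z))) \<partial>?\<nu>) = (\<integral>\<^sup>+z. S (V z) \<partial>?\<nu>)"
    by (rule nn_integral_cong_AE) (use H_AE in \<open>auto elim!: AE_mp\<close>)
  moreover have "(\<integral>z. K \<partial>?\<nu>) = K" using \<nu>.prob_space by simp
  ultimately have "ext_integral M L = ext_integral ?\<nu> H"
    unfolding L_res(2) H_res(2) q_W q_V l_int(2) by (simp only:)
  moreover have "\<nu> = (\<lambda>j. distr M borel (X j) \<Otimes>\<^sub>M unif)"
    by (simp add: fun_eq_iff \<nu>_def \<mu>_def)
  ultimately show ?thesis using L_res(1) H_res(1) by (simp only: simp_thms)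
qed

theorem theorem2p4:
  fixes n :: nat
    and M :: "'a measure" and X U :: "nat \<Rightarrow> 'a \<Rightarrow> real"
    and N :: "(nat \<Rightarrow> real) \<Rightarrow> (nat \<Rightarrow> real) \<Rightarrow> 'b measure"
    and Y :: "(nat \<Rightarrow> real) \<Rightarrow> (nat \<Rightarrow> real) \<Rightarrow> nat \<Rightarrow> 'b \<Rightarrow> real"
    and g :: "(nat \<Rightarrow> real \<times> real) \<Rightarrow> real"
    and L :: "'a \<Rightarrow> real" and H :: "(nat \<Rightarrow> real \<times> real) \<Rightarrow> real"
  assumes M: "prob_space M"
    and indep_X: "prob_space.indep_vars M (\<lambda>_. borel) X {1..n}"
    and integrable_X: "\<And>j. j \<in> {1..n} \<Longrightarrow> integrable M (X j)"
    and zero_mean_X: "\<And>j. j \<in> {1..n} \<Longrightarrow> (\<integral>\<omega>. X j \<omega> \<partial>M) = 0"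
    and indep_U: "prob_space.indep_vars M (\<lambda>_. borel) U {1..n}"
    and uniform_U: "\<And>j. j \<in> {1..n} \<Longrightarrow> distr M borel (U j) = uniform_measure lborel {0..1}"
    and indep_X_U: "prob_space.indep_var M
          (\<Pi>\<^sub>M j\<in>{1..n}. borel) (\<lambda>\<omega>. \<lambda>j\<in>{1..n}. X j \<omega>)
          (\<Pi>\<^sub>M j\<in>{1..n}. borel) (\<lambda>\<omega>. \<lambda>j\<in>{1..n}. U j \<omega>)"
    and two_point: "\<And>a b. (\<And>j. j \<in> {1..n} \<Longrightarrow> a j * b j \<le> 0) \<Longrightarrow>
          two_point_vars n (N a b) a b (Y a b)"
    and g_borel: "g \<in> borel_measurable (\<Pi>\<^sub>M j\<in>{1..n}. borel)"
    and g_bdd: "bdd_below_or_above n g \<or>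
          (\<exists>c::nat \<Rightarrow> real. bdd_below_or_above n (\<lambda>z. g z - (\<Sum>j=1..n. c j * fst (z j))))"
    \<comment> \<open>The integrands on the two sides; arbitrary where some reciprocating value is infinite.\<close>
    and L: "\<And>\<omega>. \<omega> \<in> space M \<Longrightarrow>
          (\<And>j. j \<in> {1..n} \<Longrightarrow> U j \<omega> \<in> {0..1} \<and> \<bar>recip_rv M (X j) (X j \<omega>) (U j \<omega>)\<bar> \<noteq> \<infinity>) \<Longrightarrow>
          L \<omega> = g (\<lambda>j\<in>{1..n}. (X j \<omega>, real_of_ereal (recip_rv M (X j) (X j \<omega>) (U j \<omega>))))"
    and H: "\<And>z a b. z \<in> {1..n} \<rightarrow>\<^sub>E UNIV \<times> {0..1} \<Longrightarrow>
          (\<And>j. j \<in> {1..n} \<Longrightarrow> \<bar>recip_rv M (X j) (fst (z j)) (snd (z j))\<bar> \<noteq> \<infinity>) \<Longrightarrow>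
          a = (\<lambda>j. fst (z j)) \<Longrightarrow>
          b = (\<lambda>j. real_of_ereal (recip_rv M (X j) (fst (z j)) (snd (z j)))) \<Longrightarrow>
          H z = (\<integral>\<omega>. g (\<lambda>j\<in>{1..n}. (Y a b j \<omega>, two_point_R (a j) (b j) (Y a b j \<omega>))) \<partial>N a b)"
  shows "quasi_integrable M L \<and>
    quasi_integrable (\<Pi>\<^sub>M j\<in>{1..n}. distr M borel (X j) \<Otimes>\<^sub>M uniform_measure lborel {0..1}) H \<and>
    ext_integral M L =
      ext_integral (\<Pi>\<^sub>M j\<in>{1..n}. distr M borel (X j) \<Otimes>\<^sub>M uniform_measure lborel {0..1}) H"
proof -
  let ?\<nu> = "\<Pi>\<^sub>M j\<in>{1..n}. distr M borel (X j) \<Otimes>\<^sub>M uniform_measure lborel {0..1}"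
  obtain c where c: "bdd_below_or_above n (\<lambda>z. g z - (\<Sum>j=1..n. c j * fst (z j)))"
  proof (cases "bdd_below_or_above n g")
    case True
    then show ?thesis by (intro that[of "\<lambda>_. 0"]) simp
  qed (use g_bdd that in blast)
  consider (below) K where "\<And>y. y \<in> {1..n} \<rightarrow>\<^sub>E UNIV \<Longrightarrow> K \<le> g y - (\<Sum>j=1..n. c j * fst (y j))"
    | (above) K where "\<And>y. y \<in> {1..n} \<rightarrow>\<^sub>E UNIV \<Longrightarrow> g y - (\<Sum>j=1..n. c j * fst (y j)) \<le> K"
    using c unfolding bdd_below_or_above_def bdd_below_def bdd_above_def by blast
  then show ?thesis
  proof cases
    case below
    then have lower: "K + (\<Sum>j=1..n. c j * fst (y j)) \<le> g y" if "y \<in> {1..n} \<rightarrow>\<^sub>E UNIV" for y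
      using below[OF that] by linarith
    show ?thesis
      by (rule expectation_disintegration_bounded_below[OF M indep_X integrable_X zero_mean_X
            indep_U uniform_U indep_X_U two_point g_borel lower L H])
  next
    \<comment> \<open>\<open>- L\<close> and \<open>- H\<close> satisfy the hypotheses for
      \<open>- g\<close>. For \<open>H\<close> this uses that the Bochner integral commutes with
      negation whether or not the integrand is integrable.\<close>
    case above
    have lower: "- K + (\<Sum>j=1..n. - c j * fst (y j)) \<le> - g y" if "y \<in> {1..n} \<rightarrow>\<^sub>E UNIV" for y
      using above[OF that] by (simp add: sum_negf)
    have g': "(\<lambda>y. - g y) \<in> borel_measurable (\<Pi>\<^sub>M j\<in>{1..n}. borel)"
      using g_borel by simp
    have L': "- L \<omega> = - g (\<lambda>j\<in>{1..n}. (X j \<omega>, real_of_ereal (recip_rv M (X j) (X j \<omega>) (U j \<omega>))))"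
      if "\<omega> \<in> space M"
        "\<And>j. j \<in> {1..n} \<Longrightarrow> U j \<omega> \<in> {0..1} \<and> \<bar>recip_rv M (X j) (X j \<omega>) (U j \<omega>)\<bar> \<noteq> \<infinity>" for \<omega>
      using L[OF that] by simp
    have H': "- H z = (\<integral>\<omega>. - g (\<lambda>j\<in>{1..n}. (Y a b j \<omega>, two_point_R (a j) (b j) (Y a b j \<omega>))) \<partial>N a b)"
      if "z \<in> {1..n} \<rightarrow>\<^sub>E UNIV \<times> {0..1}"
        "\<And>j. j \<in> {1..n} \<Longrightarrow> \<bar>recip_rv M (X j) (fst (z j)) (snd (z j))\<bar> \<noteq> \<infinity>"
        "a = (\<lambda>j. fst (z j))"
        "b = (\<lambda>j. real_of_ereal (recip_rv M (X j) (fst (z j)) (snd (z j))))" for z a b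
      using H[OF that] by simp
    have neg: "quasi_integrable M (\<lambda>\<omega>. - L \<omega>) \<and> quasi_integrable ?\<nu> (\<lambda>z. - H z) \<and>
        ext_integral M (\<lambda>\<omega>. - L \<omega>) = ext_integral ?\<nu> (\<lambda>z. - H z)"
      by (rule expectation_disintegration_bounded_below[OF M indep_X integrable_X zero_mean_X
            indep_U uniform_U indep_X_U two_point g' lower L' H'])
    then have "quasi_integrable M L" "quasi_integrable ?\<nu> H"
      by (simp_all add: quasi_integrable_minus_iff)
    with neg show ?thesis by (simp add: ext_integral_minus)
  qed
qed

end
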